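(* Let $(X_q)_{q \in Q}$ be a sequence of vector spaces, where $X_q$ is a vector space over $\mathbb{F}_q$ and all $X_q$ have the same dimension $N \ge 3$. Let $1 \le k \le N-1$ be an integer and let $(\mathcal{A}_q)_{q \in Q}$ be a sequence of non-empty collections of linear spaces, all of which have codimension $k$, with $A_q \le X_q$ for all $q \in Q$ and $A_q \in \mathcal{A}_q$. For $q \in Q$, denote by $\mathcal{F}_q$ the collection of $k$-dimensional subspaces $W_q \le X_q$ that intersect some $A_q \in \mathcal{A}_q$, and by $\mathcal{F}'_q$ the collection of $k$-dimensional subspaces $W_q \le X_q$ that distinguish every $A_q \in \mathcal{A}_q$. Then the following hold. (1) We have $\frac{|\mathcal{F}_q|}{\binom{N}{k}_q} \in O \left( \frac{|\mathcal{A}_q|}{q} \right)$ as $q \to +\infty$. In particular, if $|\mathcal{A}_q| \in o(q)$ as $q \to +\infty$, then $\lim_{q \to +\infty} |\mathcal{F}_q|/\binom{N}{k}_q =0$. (2) Suppose that $(\mathcal{A}_q)_{q \in Q}$ is an asymptotic partial spread. Then $\frac{|\mathcal{F}'_q|}{\binom{N}{k}_q} \in O \left( \frac{q}{|\mathcal{A}_q|} \right)$ as $q \to +\infty$. In particular, if $q \in o(|\mathcal{A}_q|)$ as $q \to +\infty$, then $\lim_{q \to +\infty} |\mathcal{F}'_q|/\binom{N}{k}_q =0$. (3) Suppose that $q \in o(|\mathcal{A}_q|)$ as $q \to +\infty$ and that there exist $\overline{q} \in Q$ and an integer $\ell$ with $\max\{0,N-2k\} \le \ell < N-k-1$ or $\ell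 = \max\{0,N-2k\} = N-k-1$ that satisfy $$\max\{\dim(A_q \cap A'_q) \mid (A_q, A'_q) \in \mathcal{A}_q^2, \, A_q \neq A'_q\} \le \ell \quad \text{for all } q \in Q,\ q \ge \overline{q}.$$ Then: (3a) if $\ell = \max\{0,N-2k\}$, then $\frac{|\mathcal{F}'_q|}{\binom{N}{k}_q} \in O \left( \frac{q}{|\mathcal{A}_q|} \right)$ as $q \to +\infty$; (3b) if $\ell > \max\{0,N-2k\}$, then $\frac{|\mathcal{F}'_q|}{\binom{N}{k}_q} \in O \left( \frac{q}{|\mathcal{A}_q|} + q^{-N+k+\ell+1} \right)$ as $q \to +\infty$. In either case, $\lim_{q \to +\infty} |\mathcal{F}'_q|/\binom{N}{k}_q =0$.
   Context: $Q$ denotes the set of prime powers; limits and Bachmann-Landau symbols ($O$, $o$, $\sim$) as $q\to+\infty$ are taken over $q \in Q$, with $N,k,\ell$ fixed. $\binom{a}{b}_q = \prod_{i=0}^{b-1} \frac{q^a-q^i}{q^b-q^i}$ is the $q$-binomial coefficient. For subspaces $W,A\le X$, $W$ distinguishes $A$ if $W\cap A=\{0\}$, and $W$ intersects $A$ otherwise. A sequence $(\mathcal{A}_q)_{q\in Q}$ of collections of subspaces $A_q \le X_q$, all of the same dimension $s$ (here $s=N-k$), is called an asymptotic partial spread if $\left| \bigcup_{A_q \in \mathcal{A}_q} A_q\right| \sim |\mathcal{A}_q| \, q^s$ as $q \to +\infty$. *)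

theory Defs
  imports
    "HOL-Library.Landau_Symbols"
    "HOL-Number_Theory.Prime_Powers"
    "Jordan_Normal_Form.Missing_VectorSpace"
begin

definition prime_powers :: "nat set" where
  "prime_powers = {q. primepow q}"

definition prime_powers_at_top :: "nat filter" where
  "prime_powers_at_top = inf at_top (principal prime_powers)"

lemma eventually_prime_powers_at_top:
  "eventually P prime_powers_at_top \<longleftrightarrow> (\<exists>q0. \<forall>q\<in>prime_powers. q0 \<le> q \<longrightarrow> P q)"
  unfolding prime_powers_at_top_def eventually_inf_principal eventually_at_top_linorder
  by blast

definition qbinomial :: "nat \<Rightarrow> nat \<Rightarrow> nat \<Rightarrow> real" where
  "qbinomial q a b =
     (\<Prod>i<b. (real q ^ a - real q ^ i) / (real q ^ b - real q ^ i))"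

definition subspace_dim ::
    "('a, 'r) ring_scheme \<Rightarrow> ('a, 'b, 'm) module_scheme \<Rightarrow> 'b set \<Rightarrow> nat" where
  "subspace_dim K V W = vectorspace.dim K (V\<lparr>carrier := W\<rparr>)"

(* subspace is the locale of AFP VectorSpace, which takes the subspace as a carrier set *)
definition subspaces_of_dim ::
    "('a, 'r) ring_scheme \<Rightarrow> ('a, 'b, 'm) module_scheme \<Rightarrow> nat \<Rightarrow> 'b set set" where
  "subspaces_of_dim K V d = {W. subspace K W V \<and> subspace_dim K V W = d}"

definition distinguishes :: "('a, 'b, 'm) module_scheme \<Rightarrow> 'b set \<Rightarrow> 'b set \<Rightarrow> bool" where
  "distinguishes V W A \<longleftrightarrow> W \<inter> A = {\<zero>\<^bsub>V\<^esub>}"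

abbreviation intersects :: "('a, 'b, 'm) module_scheme \<Rightarrow> 'b set \<Rightarrow> 'b set \<Rightarrow> bool" where
  "intersects V W A \<equiv> \<not> distinguishes V W A"

definition intersecting_subspaces ::
    "('a, 'r) ring_scheme \<Rightarrow> ('a, 'b, 'm) module_scheme \<Rightarrow> nat \<Rightarrow> 'b set set \<Rightarrow> 'b set set" where
  "intersecting_subspaces K V k \<A> =
     {W \<in> subspaces_of_dim K V k. \<exists>A\<in>\<A>. intersects V W A}"

definition distinguishing_subspaces ::
    "('a, 'r) ring_scheme \<Rightarrow> ('a, 'b, 'm) module_scheme \<Rightarrow> nat \<Rightarrow> 'b set set \<Rightarrow> 'b set set" where
  "distinguishing_subspaces K V k \<A> =
     {W \<in> subspaces_of_dim K V k. \<forall>A\<in>\<A>. distinguishes V W A}"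

definition asymptotic_partial_spread ::
    "(nat \<Rightarrow> ('a, 'r) ring_scheme) \<Rightarrow> (nat \<Rightarrow> ('a, 'b, 'm) module_scheme) \<Rightarrow> nat \<Rightarrow>
     (nat \<Rightarrow> 'b set set) \<Rightarrow> bool" where
  "asymptotic_partial_spread K X s \<A> \<longleftrightarrow>
     (\<forall>q\<in>prime_powers. \<A> q \<subseteq> subspaces_of_dim (K q) (X q) s) \<and>
     (\<lambda>q. real (card (\<Union>(\<A> q)))) \<sim>[prime_powers_at_top]
       (\<lambda>q. real (card (\<A> q)) * real q ^ s)"

end

theory Submission
  imports Defs
begin

text \<open>
  Write \<open>\<Omega>\<close> for the set of \<open>k\<close>-dimensional subspaces, so that \<open>|\<Omega>|\<close> is the \<open>q\<close>-binomial
  coefficient, and put \<open>s = N - k\<close>. Every part of the theorem follows from an inequality that holds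
  for each single prime power \<open>q\<close>, with constants that depend on \<open>k\<close> only.

  For the bound on intersecting subspaces, note that a subspace \<open>W\<close> that meets \<open>A\<close> nontrivially
  contains at least \<open>q - 1\<close> nonzero vectors of \<open>A\<close>. A uniformly random \<open>W\<close> contains a given nonzero vector with probability
  \<open>(q^k - 1) / (q^N - 1) \<le> q^(-s)\<close>, so it meets \<open>A\<close> with probability at most \<open>1 / (q - 1)\<close>; sum over
  the collection (\<open>card_intersecting_subspaces_le\<close>).

  For distinguishing subspaces the second moment method is applied not to the events \<open>W \<inter> A \<noteq> 0\<close>
  but to the events \<open>x \<in> W\<close>, for the nonzero vectors \<open>x\<close> covered by the collection. If \<open>x\<close> and \<open>y\<close> are not
  proportional, these events are negatively correlated, exactly and not just up to an error term.
  Weight \<open>x\<close> by \<open>m(x) \<ge> 0\<close>, constant on lines. Chebyshev's inequality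
  (\<open>weighted_second_moment\<close>) then bounds the proportion of \<open>W\<close> that avoid all these \<open>x\<close> by
  \<open>2 q^(s+1) (\<Sum>x. m(x)^2) / (\<Sum>x. m(x))^2\<close>. Two weights are used.
    \<^item> \<open>m = 1\<close> settles asymptotic partial spreads, whose union has about \<open>|\<A>| q^s\<close> elements
      (\<open>card_distinguishing_le_Union\<close>).
    \<^item> \<open>m(x) = |{A \<in> \<A>. x \<in> A}|\<close> has \<open>\<Sum>x. m(x) = |\<A>| (q^s - 1)\<close>, while \<open>\<Sum>x. m(x)^2\<close> is the sum over
      all pairs of the number of nonzero vectors of \<open>A \<inter> A'\<close>. This gives a bound of order
      \<open>q / |\<A>| + q^(1-s) (q^l - 1)\<close>, when distinct members meet in dimension at most
      \<open>l\<close> (\<open>card_distinguishing_le_Int\<close>). The second term is the error term of the theorem,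
      and it vanishes for \<open>l = 0\<close>.

  In the remaining case \<open>l = N - 2 k > 0\<close> no error term is allowed. Here any two distinct
  members of the collection span the whole space, and the argument is dualized: the test objects are the hyperplanes that contain a member
  of the collection, and the events are \<open>W \<subseteq> H\<close>. Distinct members then have disjoint sets of
  hyperplanes, two events of this kind are again negatively correlated, and a hyperplane that
  contains both \<open>W\<close> and \<open>A\<close> forces \<open>W \<inter> A \<noteq> 0\<close> (\<open>card_distinguishing_le_dual\<close>).

  All counts come from \<open>card_between\<close>, the number of \<open>d\<close>-dimensional subspaces between two given
  subspaces. Dimensions are handled through cardinalities: a subspace has dimension \<open>d\<close> iff it has
  \<open>q^d\<close> elements.
\<close>

section \<open>Cardinalities in a vector space over a finite field\<close>

text \<open>A vector space with finitely many elements over a finite field.\<close>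

locale finite_vectorspace = vectorspace K V
  for K :: "('a, 'r) ring_scheme" and V :: "('a, 'b, 'm) module_scheme" +
  assumes finite_scalars: "finite (carrier K)"
    and finite_vectors: "finite (carrier V)"

lemma (in vectorspace) bij_betw_lincomb_basis:
  assumes "finite B" "basis B"
  shows "bij_betw (\<lambda>a. lincomb a B) (B \<rightarrow>\<^sub>E carrier K) (carrier V)"
proof -
  have "B \<subseteq> carrier V" using assms(2) by (simp add: basis_def)
  then have ex1: "\<forall>v. v \<in> carrier V \<longrightarrow> (\<exists>!a. a \<in> B \<rightarrow>\<^sub>E carrier K \<and> lincomb a B = v)"
    using assms basis_criterion[of B] by simp
  have closed: "lincomb a B \<in> carrier V" if "a \<in> B \<rightarrow>\<^sub>E carrier K" for a
    using that \<open>B \<subseteq> carrier V\<close> by (intro lincomb_closed) auto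
  show ?thesis
  proof (rule bij_betwI')
    fix a b assume "a \<in> B \<rightarrow>\<^sub>E carrier K" "b \<in> B \<rightarrow>\<^sub>E carrier K"
    then show "(lincomb a B = lincomb b B) = (a = b)"
      using ex1 closed by metis
  next
    fix v assume "v \<in> carrier V"
    then show "\<exists>a\<in>B \<rightarrow>\<^sub>E carrier K. v = lincomb a B" using ex1 by metis
  qed (rule closed)
qed

lemma finite_vectorspaceI:
  assumes V: "vectorspace K V" and K: "finite (carrier K)" and fd: "vectorspace.fin_dim K V"
  shows "finite_vectorspace K V"
proof -
  obtain B where B: "finite B" "vectorspace.basis K V B"
    using vectorspace.finite_basis_exists[OF V fd] by blast
  have "finite (B \<rightarrow>\<^sub>E carrier K)" using B(1) K by (intro finite_PiE)
  then have "finite (carrier V)"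
    using bij_betw_finite[OF vectorspace.bij_betw_lincomb_basis[OF V B]] by (rule iffD1[rotated])
  then show ?thesis using V K by (intro finite_vectorspace.intro finite_vectorspace_axioms.intro)
qed

context finite_vectorspace
begin

abbreviation q :: nat where "q \<equiv> card (carrier K)"

lemma two_le_q: "2 \<le> q"
proof -
  have "{\<zero>\<^bsub>K\<^esub>, \<one>\<^bsub>K\<^esub>} \<subseteq> carrier K" by auto
  then have "card {\<zero>\<^bsub>K\<^esub>, \<one>\<^bsub>K\<^esub>} \<le> q" using finite_scalars by (rule card_mono[rotated])
  then show ?thesis by simp
qed

lemma subspaceI:
  assumes "W \<subseteq> carrier V" "\<zero>\<^bsub>V\<^esub> \<in> W"
    and "\<And>v w. v \<in> W \<Longrightarrow> w \<in> W \<Longrightarrow> v \<oplus>\<^bsub>V\<^esub> w \<in> W"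
    and "\<And>c v. c \<in> carrier K \<Longrightarrow> v \<in> W \<Longrightarrow> c \<odot>\<^bsub>V\<^esub> v \<in> W"
  shows "subspace K W V"
  using assms vectorspace_axioms module_axioms
  by (auto simp: subspace_def submodule_def)

lemma subspace_subset: "subspace K W V \<Longrightarrow> W \<subseteq> carrier V"
  and subspace_zero: "subspace K W V \<Longrightarrow> \<zero>\<^bsub>V\<^esub> \<in> W"
  and subspace_add: "subspace K W V \<Longrightarrow> v \<in> W \<Longrightarrow> w \<in> W \<Longrightarrow> v \<oplus>\<^bsub>V\<^esub> w \<in> W"
  and subspace_smult: "subspace K W V \<Longrightarrow> c \<in> carrier K \<Longrightarrow> v \<in> W \<Longrightarrow> c \<odot>\<^bsub>V\<^esub> v \<in> W"
  by (simp_all add: subspace_def submodule_def)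

lemma subspace_uminus: "subspace K W V \<Longrightarrow> v \<in> W \<Longrightarrow> \<ominus>\<^bsub>V\<^esub> v \<in> W"
proof -
  assume W: "subspace K W V" and v: "v \<in> W"
  have "\<ominus>\<^bsub>V\<^esub> v = (\<ominus>\<^bsub>K\<^esub> \<one>\<^bsub>K\<^esub>) \<odot>\<^bsub>V\<^esub> v"
    using subspace_subset[OF W] v by (simp add: smult_minus_1 subset_iff)
  then show "\<ominus>\<^bsub>V\<^esub> v \<in> W" using subspace_smult[OF W] v by simp
qed

lemma subspace_minus: "subspace K W V \<Longrightarrow> v \<in> W \<Longrightarrow> w \<in> W \<Longrightarrow> v \<ominus>\<^bsub>V\<^esub> w \<in> W"
  by (simp add: a_minus_def subspace_add subspace_uminus)

lemma subspace_finite: "subspace K W V \<Longrightarrow> finite W"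
  using finite_vectors subspace_subset finite_subset by blast

lemma finite_subspaces: "finite {W. subspace K W V}"
  by (rule finite_subset[of _ "Pow (carrier V)"]) (use subspace_subset finite_vectors in auto)

lemma subspace_carrier: "subspace K (carrier V) V"
  by (rule subspaceI) auto

lemma subspace_zero_space: "subspace K {\<zero>\<^bsub>V\<^esub>} V"
  by (rule subspaceI) auto

lemma subspace_Int: "subspace K A V \<Longrightarrow> subspace K B V \<Longrightarrow> subspace K (A \<inter> B) V"
  by (rule subspaceI) (use subspace_subset subspace_zero subspace_add subspace_smult in auto)

lemma fin_dim_finite: fin_dim
  unfolding fin_dim_def
  using finite_vectors span_is_subset2[of "carrier V"] in_own_span[of "carrier V"] by blast

lemma card_carrier: "card (carrier V) = q ^ dim"
proof -
  obtain B where B: "finite B" "basis B"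
    using finite_basis_exists[OF fin_dim_finite] by blast
  have "card (carrier V) = card (B \<rightarrow>\<^sub>E carrier K)"
    using bij_betw_lincomb_basis[OF B] by (simp add: bij_betw_same_card)
  also have "\<dots> = q ^ card B"
    using B by (simp add: card_PiE)
  finally show ?thesis using dim_basis[OF B] by simp
qed

lemma finite_vectorspace_subspace:
  assumes "subspace K W V"
  shows "finite_vectorspace K (vs W)"
  using subspace_is_vs[OF assms] finite_scalars subspace_finite[OF assms]
  by (simp add: finite_vectorspace_def finite_vectorspace_axioms_def)

lemma card_subspace:
  assumes "subspace K W V"
  shows "card W = q ^ subspace_dim K V W"
  using finite_vectorspace.card_carrier[OF finite_vectorspace_subspace[OF assms]]
  by (simp add: subspace_dim_def)

lemma subspaces_of_dim_iff_card:
  "W \<in> subspaces_of_dim K V d \<longleftrightarrow> subspace K W V \<and> card W = q ^ d"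
  using card_subspace[of W] two_le_q by (auto simp: subspaces_of_dim_def)

text \<open>The subspace \<open>U + \<langle>v\<rangle>\<close>, for a subspace \<open>U\<close>.\<close>

definition adjoin :: "'b set \<Rightarrow> 'b \<Rightarrow> 'b set" where
  "adjoin U v = (\<lambda>(u, c). u \<oplus>\<^bsub>V\<^esub> c \<odot>\<^bsub>V\<^esub> v) ` (U \<times> carrier K)"

lemma subspace_adjoin:
  assumes U: "subspace K U V" and v: "v \<in> carrier V"
  shows "subspace K (adjoin U v) V"
proof (rule subspaceI)
  have Uc: "\<And>u. u \<in> U \<Longrightarrow> u \<in> carrier V" using subspace_subset[OF U] by auto
  show "adjoin U v \<subseteq> carrier V" using Uc v by (auto simp: adjoin_def)
  show "\<zero>\<^bsub>V\<^esub> \<in> adjoin U v"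
    using subspace_zero[OF U] v
    by (auto simp: adjoin_def image_iff intro!: bexI[of _ "\<zero>\<^bsub>V\<^esub>"] bexI[of _ "\<zero>\<^bsub>K\<^esub>"])
  fix x assume "x \<in> adjoin U v"
  then obtain u c where x: "u \<in> U" "c \<in> carrier K" "x = u \<oplus>\<^bsub>V\<^esub> c \<odot>\<^bsub>V\<^esub> v"
    by (auto simp: adjoin_def)
  {
    fix y assume "y \<in> adjoin U v"
    then obtain u' c' where y: "u' \<in> U" "c' \<in> carrier K" "y = u' \<oplus>\<^bsub>V\<^esub> c' \<odot>\<^bsub>V\<^esub> v"
      by (auto simp: adjoin_def)
    have "x \<oplus>\<^bsub>V\<^esub> y = (u \<oplus>\<^bsub>V\<^esub> u') \<oplus>\<^bsub>V\<^esub> (c \<oplus>\<^bsub>K\<^esub> c') \<odot>\<^bsub>V\<^esub> v"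
      using x y v Uc by (simp add: smult_l_distr M.add.m_ac)
    then show "x \<oplus>\<^bsub>V\<^esub> y \<in> adjoin U v"
      using x y subspace_add[OF U] by (auto simp: adjoin_def image_iff)
  }
  fix d assume d: "d \<in> carrier K"
  have "d \<odot>\<^bsub>V\<^esub> x = d \<odot>\<^bsub>V\<^esub> u \<oplus>\<^bsub>V\<^esub> (d \<otimes>\<^bsub>K\<^esub> c) \<odot>\<^bsub>V\<^esub> v"
    using x v d Uc by (simp add: smult_r_distr smult_assoc1)
  then show "d \<odot>\<^bsub>V\<^esub> x \<in> adjoin U v"
    using x d subspace_smult[OF U] by (auto simp: adjoin_def image_iff)
qed

lemma adjoin_subset_iff:
  assumes U: "subspace K U V" and v: "v \<in> carrier V" and W: "subspace K W V"
  shows "adjoin U v \<subseteq> W \<longleftrightarrow> U \<subseteq> W \<and> v \<in> W"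
proof
  have Uc: "\<And>u. u \<in> U \<Longrightarrow> u \<in> carrier V" using subspace_subset[OF U] by auto
  have "u \<in> adjoin U v" if "u \<in> U" for u
    using that v Uc by (auto simp: adjoin_def image_iff intro!: bexI[of _ u] bexI[of _ "\<zero>\<^bsub>K\<^esub>"])
  moreover have "v \<in> adjoin U v"
    using v subspace_zero[OF U]
    by (auto simp: adjoin_def image_iff intro!: bexI[of _ "\<zero>\<^bsub>V\<^esub>"] bexI[of _ "\<one>\<^bsub>K\<^esub>"])
  ultimately show "adjoin U v \<subseteq> W \<Longrightarrow> U \<subseteq> W \<and> v \<in> W" by blast
  show "U \<subseteq> W \<and> v \<in> W \<Longrightarrow> adjoin U v \<subseteq> W"
    using subspace_add[OF W] subspace_smult[OF W] by (auto simp: adjoin_def)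
qed

lemma card_adjoin:
  assumes U: "subspace K U V" and v: "v \<in> carrier V" "v \<notin> U"
  shows "card (adjoin U v) = card U * q"
proof -
  have Uc: "\<And>u. u \<in> U \<Longrightarrow> u \<in> carrier V" using subspace_subset[OF U] by auto
  have "c = c' \<and> u = u'"
    if *: "u \<in> U" "u' \<in> U" "c \<in> carrier K" "c' \<in> carrier K"
      "u \<oplus>\<^bsub>V\<^esub> c \<odot>\<^bsub>V\<^esub> v = u' \<oplus>\<^bsub>V\<^esub> c' \<odot>\<^bsub>V\<^esub> v" for u u' c c'
  proof -
    define e where "e = c \<ominus>\<^bsub>K\<^esub> c'"
    have e: "e \<in> carrier K" using * by (simp add: e_def)
    have carr: "u \<in> carrier V" "u' \<in> carrier V" "c \<odot>\<^bsub>V\<^esub> v \<in> carrier V" "c' \<odot>\<^bsub>V\<^esub> v \<in> carrier V"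
      using * Uc v by auto
    have "c \<odot>\<^bsub>V\<^esub> v = \<ominus>\<^bsub>V\<^esub> u \<oplus>\<^bsub>V\<^esub> (u \<oplus>\<^bsub>V\<^esub> c \<odot>\<^bsub>V\<^esub> v)"
      using carr by (simp add: M.r_neg1)
    also have "\<dots> = \<ominus>\<^bsub>V\<^esub> u \<oplus>\<^bsub>V\<^esub> (u' \<oplus>\<^bsub>V\<^esub> c' \<odot>\<^bsub>V\<^esub> v)"
      using * by simp
    finally have "c \<odot>\<^bsub>V\<^esub> v \<ominus>\<^bsub>V\<^esub> c' \<odot>\<^bsub>V\<^esub> v = \<ominus>\<^bsub>V\<^esub> u \<oplus>\<^bsub>V\<^esub> u'"
      using carr by (simp add: a_minus_def M.a_assoc M.r_neg)
    moreover have "e \<odot>\<^bsub>V\<^esub> v = c \<odot>\<^bsub>V\<^esub> v \<ominus>\<^bsub>V\<^esub> c' \<odot>\<^bsub>V\<^esub> v"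
      using * v by (simp add: e_def a_minus_def smult_l_distr smult_l_minus)
    ultimately have eU: "e \<odot>\<^bsub>V\<^esub> v \<in> U"
      using subspace_add[OF U] subspace_uminus[OF U] * by simp
    have "e = \<zero>\<^bsub>K\<^esub>"
    proof (rule ccontr)
      assume "e \<noteq> \<zero>\<^bsub>K\<^esub>"
      then have i: "e \<in> Units K" "inv\<^bsub>K\<^esub> e \<in> carrier K" using e field_Units by auto
      have "v = (inv\<^bsub>K\<^esub> e) \<odot>\<^bsub>V\<^esub> (e \<odot>\<^bsub>V\<^esub> v)"
        using i e v by (simp flip: smult_assoc1)
      then show False using subspace_smult[OF U i(2) eU] v by simp
    qed
    then have "c = c'" using * by (simp add: e_def)
    then show ?thesis using * Uc v by simp
  qed
  then have "inj_on (\<lambda>(u, c). u \<oplus>\<^bsub>V\<^esub> c \<odot>\<^bsub>V\<^esub> v) (U \<times> carrier K)"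
    by (auto simp: inj_on_def)
  then show ?thesis
    by (simp add: adjoin_def card_image card_cartesian_product)
qed

text \<open>
  This replaces the dimension formula for \<open>A + B\<close>: the nonempty fibres of \<open>(a, b) \<mapsto> a + b\<close> on \<open>A \<times> B\<close>
  embed into \<open>A \<inter> B\<close>, and the image lies in \<open>C\<close>.
\<close>

lemma card_mult_le:
  assumes A: "subspace K A V" and B: "subspace K B V" and C: "subspace K C V"
    and sub: "A \<subseteq> C" "B \<subseteq> C"
  shows "card A * card B \<le> card C * card (A \<inter> B)"
proof -
  let ?f = "\<lambda>(a, b). a \<oplus>\<^bsub>V\<^esub> b"
  have Ac: "\<And>u. u \<in> A \<Longrightarrow> u \<in> carrier V" and Bc: "\<And>u. u \<in> B \<Longrightarrow> u \<in> carrier V"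
    using subspace_subset[OF A] subspace_subset[OF B] by auto
  have fin: "finite A" "finite B" "finite C" using A B C subspace_finite by auto
  have fiber: "card {x \<in> A \<times> B. ?f x = c} \<le> card (A \<inter> B)" if c: "c \<in> ?f ` (A \<times> B)" for c
  proof -
    obtain a0 b0 where 0: "a0 \<in> A" "b0 \<in> B" "c = a0 \<oplus>\<^bsub>V\<^esub> b0"
      using c by auto
    have key: "a \<ominus>\<^bsub>V\<^esub> a0 = b0 \<ominus>\<^bsub>V\<^esub> b" if "a \<in> A" "b \<in> B" "a \<oplus>\<^bsub>V\<^esub> b = c" for a b
    proof -
      have carr: "a \<in> carrier V" "b \<in> carrier V" "a0 \<in> carrier V" "b0 \<in> carrier V"
        using that Ac Bc 0 by auto
      have "a = (a \<oplus>\<^bsub>V\<^esub> b) \<oplus>\<^bsub>V\<^esub> \<ominus>\<^bsub>V\<^esub> b"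
        using carr by (simp add: M.a_assoc M.r_neg)
      also have "\<dots> = a0 \<oplus>\<^bsub>V\<^esub> (b0 \<ominus>\<^bsub>V\<^esub> b)"
        using carr that(3) 0(3) by (simp add: a_minus_def M.a_assoc)
      finally have "a \<ominus>\<^bsub>V\<^esub> a0 = (a0 \<oplus>\<^bsub>V\<^esub> (b0 \<ominus>\<^bsub>V\<^esub> b)) \<ominus>\<^bsub>V\<^esub> a0" by simp
      also have "\<dots> = \<ominus>\<^bsub>V\<^esub> a0 \<oplus>\<^bsub>V\<^esub> (a0 \<oplus>\<^bsub>V\<^esub> (b0 \<ominus>\<^bsub>V\<^esub> b))"
        using carr by (simp add: a_minus_def M.a_comm)
      also have "\<dots> = b0 \<ominus>\<^bsub>V\<^esub> b"
        using carr by (simp add: M.r_neg1)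
      finally show ?thesis .
    qed
    show ?thesis
    proof (rule card_inj_on_le)
      show "inj_on (\<lambda>(a, b). a \<ominus>\<^bsub>V\<^esub> a0) {x \<in> A \<times> B. ?f x = c}"
      proof (rule inj_onI, clarsimp)
        fix a b a' b'
        assume h: "a \<in> A" "b \<in> B" "a' \<in> A" "b' \<in> B" "a' \<oplus>\<^bsub>V\<^esub> b' = a \<oplus>\<^bsub>V\<^esub> b"
          "a \<ominus>\<^bsub>V\<^esub> a0 = a' \<ominus>\<^bsub>V\<^esub> a0"
        then have "a = a'" using 0 Ac by (simp add: a_minus_def)
        then show "a = a' \<and> b = b'" using h Ac Bc by simp
      qed
      show "(\<lambda>(a, b). a \<ominus>\<^bsub>V\<^esub> a0) ` {x \<in> A \<times> B. ?f x = c} \<subseteq> A \<inter> B"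
      proof (rule image_subsetI)
        fix x assume "x \<in> {x \<in> A \<times> B. ?f x = c}"
        then obtain a b where h: "x = (a, b)" "a \<in> A" "b \<in> B" "a \<oplus>\<^bsub>V\<^esub> b = c" by auto
        have "a \<ominus>\<^bsub>V\<^esub> a0 \<in> A" using h 0 subspace_minus[OF A] by simp
        moreover have "a \<ominus>\<^bsub>V\<^esub> a0 \<in> B" using h 0 subspace_minus[OF B] key[of a b] by simp
        ultimately show "(\<lambda>(a, b). a \<ominus>\<^bsub>V\<^esub> a0) x \<in> A \<inter> B" using h(1) by simp
      qed
      show "finite (A \<inter> B)" using fin by simp
    qed
  qed
  have "card A * card B = (\<Sum>x\<in>A \<times> B. 1)" by (simp add: card_cartesian_product)
  also have "\<dots> = (\<Sum>c\<in>?f ` (A \<times> B). \<Sum>x\<in>{x \<in> A \<times> B. ?f x = c}. 1)"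
    by (rule sum.image_gen) (use fin in simp)
  also have "\<dots> = (\<Sum>c\<in>?f ` (A \<times> B). card {x \<in> A \<times> B. ?f x = c})" by simp
  also have "\<dots> \<le> (\<Sum>c\<in>?f ` (A \<times> B). card (A \<inter> B))"
    by (rule sum_mono) (rule fiber)
  also have "\<dots> \<le> card C * card (A \<inter> B)"
    using sub subspace_add[OF C] fin by (auto intro!: card_mono)
  finally show ?thesis .
qed

text \<open>The \<open>d\<close>-dimensional subspaces \<open>W\<close> with \<open>U \<subseteq> W \<subseteq> T\<close>.\<close>

definition between :: "'b set \<Rightarrow> 'b set \<Rightarrow> nat \<Rightarrow> 'b set set" where
  "between U T d = {W \<in> subspaces_of_dim K V d. U \<subseteq> W \<and> W \<subseteq> T}"

lemma finite_between: "finite (between U T d)"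
  by (rule finite_subset[OF _ finite_subspaces]) (auto simp: between_def subspaces_of_dim_def)

text \<open>
  By induction on \<open>d - j\<close>: count the pairs \<open>(v, W)\<close> with \<open>v \<in> W - U\<close>. Each \<open>W\<close> occurs in
  \<open>q^d - q^j\<close> of them, and the \<open>W\<close> paired with \<open>v\<close> are those between \<open>U + \<langle>v\<rangle>\<close> and \<open>T\<close>. No bound
  \<open>d \<le> n\<close> is needed: for \<open>d > n\<close> the factor \<open>i = n\<close> makes the product zero.
\<close>

lemma card_between:
  assumes T: "T \<in> subspaces_of_dim K V n" and U: "U \<in> subspaces_of_dim K V j"
    and "U \<subseteq> T" "j \<le> d"
  shows "real (card (between U T d)) = (\<Prod>i\<in>{j..<d}. (real q ^ n - real q ^ i) / (real q ^ d - real q ^ i))"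
  using assms(2-4)
proof (induction "d - j" arbitrary: U j)
  case 0
  then have jd: "j = d" by simp
  have "between U T d = {U}"
  proof (intro equalityI subsetI)
    fix W assume "W \<in> between U T d"
    then have "W \<in> subspaces_of_dim K V d" "U \<subseteq> W" by (auto simp: between_def)
    then have "W = U"
      using 0 jd card_subset_eq[of W U] subspace_finite
      by (auto simp: subspaces_of_dim_iff_card)
    then show "W \<in> {U}" by simp
  qed (use 0 jd in \<open>auto simp: between_def\<close>)
  then show ?case using jd by simp
next
  case (Suc m)
  then have jd: "j < d" by simp
  have Ts: "subspace K T V" "card T = q ^ n" and Us: "subspace K U V" "card U = q ^ j"
    using T Suc.prems by (auto simp: subspaces_of_dim_iff_card)
  define P where "P = (\<Prod>i\<in>{Suc j..<d}. (real q ^ n - real q ^ i) / (real q ^ d - real q ^ i))"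
  have step: "real (card {W \<in> between U T d. v \<in> W}) = P" if v: "v \<in> T - U" for v
  proof -
    have vc: "v \<in> carrier V" using v subspace_subset[OF Ts(1)] by auto
    have ad: "adjoin U v \<in> subspaces_of_dim K V (Suc j)"
      using subspace_adjoin[OF Us(1) vc] card_adjoin[OF Us(1) vc] v Us
      by (simp add: subspaces_of_dim_iff_card)
    have "{W \<in> between U T d. v \<in> W} = between (adjoin U v) T d"
      using adjoin_subset_iff[OF Us(1) vc] by (auto simp: between_def subspaces_of_dim_def)
    moreover have "adjoin U v \<subseteq> T"
      using adjoin_subset_iff[OF Us(1) vc Ts(1)] v Suc.prems by auto
    ultimately show ?thesis
      using Suc.hyps(1)[of "Suc j" "adjoin U v"] ad Suc.hyps(2) jd by (simp add: P_def)
  qed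
  have fin: "finite T" "finite U" using Ts Us subspace_finite by auto
  have "(real q ^ n - real q ^ j) * P = (\<Sum>v\<in>T - U. P)"
    using Suc.prems fin Ts Us card_mono[OF fin(1) \<open>U \<subseteq> T\<close>]
    by (simp add: card_Diff_subset of_nat_diff)
  also have "\<dots> = (\<Sum>v\<in>T - U. real (card {W \<in> between U T d. v \<in> W}))"
    using step by simp
  also have "\<dots> = real (\<Sum>v\<in>T - U. card {W \<in> between U T d. v \<in> W})" by simp
  also have "(\<Sum>v\<in>T - U. card {W \<in> between U T d. v \<in> W}) = (\<Sum>W\<in>between U T d. card {v \<in> T - U. v \<in> W})"
    by (rule sum_multicount_gen) (use fin finite_between in auto)
  also have "real \<dots> = (\<Sum>W\<in>between U T d. real (card {v \<in> T - U. v \<in> W}))" by simp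
  also have "\<dots> = (\<Sum>W\<in>between U T d. real q ^ d - real q ^ j)"
  proof (rule sum.cong)
    fix W assume "W \<in> between U T d"
    then have W: "subspace K W V" "card W = q ^ d" "U \<subseteq> W" "W \<subseteq> T"
      by (auto simp: between_def subspaces_of_dim_iff_card)
    then have "{v \<in> T - U. v \<in> W} = W - U" by auto
    then show "real (card {v \<in> T - U. v \<in> W}) = real q ^ d - real q ^ j"
      using W Us fin card_mono[OF subspace_finite[OF W(1)] W(3)]
      by (simp add: card_Diff_subset of_nat_diff)
  qed simp
  finally have eq: "(real q ^ n - real q ^ j) * P = real (card (between U T d)) * (real q ^ d - real q ^ j)"
    by simp
  have pos: "real q ^ d - real q ^ j > 0" using jd two_le_q by simp
  have "real (card (between U T d)) = (real q ^ n - real q ^ j) / (real q ^ d - real q ^ j) * P"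
    using eq pos by (simp add: field_simps)
  then show ?case using jd by (simp add: P_def prod.atLeast_Suc_lessThan)
qed

end

section \<open>Chebyshev's inequality for an incidence relation\<close>

text \<open>
  Pick \<open>w \<in> \<Omega>\<close> uniformly at random and let \<open>Y w\<close> be the total weight of the \<open>x \<in> S\<close> with \<open>R x w\<close>.
  If all events \<open>R x\<close> have the same number \<open>d\<close> of outcomes and are pairwise nonpositively
  correlated, except within classes \<open>E x\<close> of size at most \<open>t\<close> on which the weight is constant, then
  the variance of \<open>Y\<close> is at most \<open>t * d / |\<Omega>|\<close> times the sum of the squared weights. When no
  \<open>R x w\<close> holds, \<open>Y w = 0\<close> differs from the mean by the mean itself.
\<close>

lemma weighted_second_moment:
  fixes \<Omega> :: "'w set" and S :: "'x set" and R :: "'x \<Rightarrow> 'w \<Rightarrow> bool"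
    and m :: "'x \<Rightarrow> real" and d t :: real
  assumes fin: "finite \<Omega>" "finite S" and ne: "\<Omega> \<noteq> {}"
    and d: "0 < d" "\<And>x. x \<in> S \<Longrightarrow> real (card {w \<in> \<Omega>. R x w}) = d"
    and neg: "\<And>x y. x \<in> S \<Longrightarrow> y \<in> S \<Longrightarrow> \<not> E x y \<Longrightarrow>
        real (card {w \<in> \<Omega>. R x w \<and> R y w}) * real (card \<Omega>) \<le> d\<^sup>2"
    and E: "\<And>x. x \<in> S \<Longrightarrow> real (card {y \<in> S. E x y}) \<le> t"
    and m: "\<And>x. x \<in> S \<Longrightarrow> 0 \<le> m x" "\<And>x y. x \<in> S \<Longrightarrow> y \<in> S \<Longrightarrow> E x y \<Longrightarrow> m y = m x"
  shows "real (card {w \<in> \<Omega>. \<forall>x\<in>S. \<not> R x w}) * d * (sum m S)\<^sup>2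
           \<le> (real (card \<Omega>))\<^sup>2 * t * (\<Sum>x\<in>S. (m x)\<^sup>2)"
proof -
  define n where "n = real (card \<Omega>)"
  have n: "n > 0" using fin ne by (simp add: n_def card_gt_0_iff)
  define M where "M = sum m S"
  \<comment> \<open>The mean of \<open>Y\<close>.\<close>
  define \<mu> where "\<mu> = d * M / n"
  define Y where "Y w = (\<Sum>x\<in>S. m x * of_bool (R x w))" for w
  have card_eq: "(\<Sum>w\<in>\<Omega>. of_bool (P w)) = real (card {w \<in> \<Omega>. P w})" for P
  proof -
    have "(\<Sum>w\<in>\<Omega>. of_bool (P w)) = (\<Sum>w\<in>\<Omega>. if P w then 1 else (0::real))"
      by (rule sum.cong) auto
    then show ?thesis using fin by (simp flip: sum.inter_filter)
  qed
  have Y1: "(\<Sum>w\<in>\<Omega>. Y w) = d * M"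
  proof -
    have "(\<Sum>w\<in>\<Omega>. Y w) = (\<Sum>x\<in>S. \<Sum>w\<in>\<Omega>. m x * of_bool (R x w))"
      unfolding Y_def by (rule sum.swap)
    also have "\<dots> = (\<Sum>x\<in>S. m x * d)"
      by (rule sum.cong) (use d card_eq in \<open>simp_all flip: sum_distrib_left\<close>)
    finally show ?thesis by (simp add: M_def sum_distrib_left mult.commute)
  qed
  have Y2: "(\<Sum>w\<in>\<Omega>. (Y w)\<^sup>2) \<le> d\<^sup>2 * M\<^sup>2 / n + t * d * (\<Sum>x\<in>S. (m x)\<^sup>2)"
  proof -
    have "(\<Sum>w\<in>\<Omega>. (Y w)\<^sup>2)
        = (\<Sum>w\<in>\<Omega>. \<Sum>x\<in>S. \<Sum>y\<in>S. m x * m y * of_bool (R x w \<and> R y w))"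
      unfolding Y_def power2_eq_square sum_product
      by (intro sum.cong refl) auto
    also have "\<dots> = (\<Sum>x\<in>S. \<Sum>w\<in>\<Omega>. \<Sum>y\<in>S. m x * m y * of_bool (R x w \<and> R y w))"
      by (rule sum.swap)
    also have "\<dots> = (\<Sum>x\<in>S. \<Sum>y\<in>S. \<Sum>w\<in>\<Omega>. m x * m y * of_bool (R x w \<and> R y w))"
      by (intro sum.cong refl sum.swap)
    also have "\<dots> = (\<Sum>x\<in>S. \<Sum>y\<in>S. m x * m y * real (card {w \<in> \<Omega>. R x w \<and> R y w}))"
      by (intro sum.cong refl) (simp only: card_eq flip: sum_distrib_left)
    also have "\<dots> \<le> (\<Sum>x\<in>S. \<Sum>y\<in>S. m x * m y * (d\<^sup>2 / n) + (if E x y then (m x)\<^sup>2 * d else 0))"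
    proof (intro sum_mono)
      fix x y assume xy: "x \<in> S" "y \<in> S"
      have mm: "0 \<le> m x * m y" using m xy by simp
      show "m x * m y * real (card {w \<in> \<Omega>. R x w \<and> R y w})
          \<le> m x * m y * (d\<^sup>2 / n) + (if E x y then (m x)\<^sup>2 * d else 0)"
      proof (cases "E x y")
        case True
        have "card {w \<in> \<Omega>. R x w \<and> R y w} \<le> card {w \<in> \<Omega>. R x w}"
          using fin by (intro card_mono) auto
        then have "real (card {w \<in> \<Omega>. R x w \<and> R y w}) \<le> d" using d(2)[OF xy(1)] by linarith
        then have "m x * m y * real (card {w \<in> \<Omega>. R x w \<and> R y w}) \<le> m x * m y * d"
          using mm by (rule mult_left_mono)
        also have "\<dots> = (m x)\<^sup>2 * d" using m(2)[OF xy True] by (simp add: power2_eq_square)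
        also have "\<dots> \<le> m x * m y * (d\<^sup>2 / n) + (m x)\<^sup>2 * d" using mm n by simp
        finally show ?thesis using True by simp
      next
        case False
        then have "real (card {w \<in> \<Omega>. R x w \<and> R y w}) \<le> d\<^sup>2 / n"
          using neg[OF xy False] n by (simp add: n_def pos_le_divide_eq)
        then have "m x * m y * real (card {w \<in> \<Omega>. R x w \<and> R y w}) \<le> m x * m y * (d\<^sup>2 / n)"
          using mm by (rule mult_left_mono)
        then show ?thesis using False by simp
      qed
    qed
    also have "\<dots> = (\<Sum>x\<in>S. \<Sum>y\<in>S. m x * m y * (d\<^sup>2 / n))
        + (\<Sum>x\<in>S. (m x)\<^sup>2 * d * real (card {y \<in> S. E x y}))"
      using fin by (simp add: sum.distrib mult.commute flip: sum.inter_filter)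
    also have "(\<Sum>x\<in>S. \<Sum>y\<in>S. m x * m y * (d\<^sup>2 / n)) = d\<^sup>2 * M\<^sup>2 / n"
      by (simp add: M_def power2_eq_square sum_product sum_distrib_left sum_distrib_right sum_divide_distrib algebra_simps)
    also have "(\<Sum>x\<in>S. (m x)\<^sup>2 * d * real (card {y \<in> S. E x y})) \<le> (\<Sum>x\<in>S. (m x)\<^sup>2 * d * t)"
      using E d(1) by (intro sum_mono mult_left_mono) auto
    also have "(\<Sum>x\<in>S. (m x)\<^sup>2 * d * t) = t * d * (\<Sum>x\<in>S. (m x)\<^sup>2)"
      by (simp add: sum_distrib_left mult_ac)
    finally show ?thesis by simp
  qed
  let ?Z = "{w \<in> \<Omega>. \<forall>x\<in>S. \<not> R x w}"
  have "real (card ?Z) * \<mu>\<^sup>2 = (\<Sum>w\<in>?Z. (Y w - \<mu>)\<^sup>2)"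
    by (simp add: Y_def)
  also have "\<dots> \<le> (\<Sum>w\<in>\<Omega>. (Y w - \<mu>)\<^sup>2)"
    using fin by (intro sum_mono2) auto
  also have "\<dots> = (\<Sum>w\<in>\<Omega>. (Y w)\<^sup>2) - 2 * \<mu> * (\<Sum>w\<in>\<Omega>. Y w) + n * \<mu>\<^sup>2"
    unfolding power2_diff sum.distrib sum_subtractf sum_distrib_left n_def
    by (simp add: mult_ac)
  also have "\<dots> = (\<Sum>w\<in>\<Omega>. (Y w)\<^sup>2) - d\<^sup>2 * M\<^sup>2 / n"
    using n by (simp add: Y1 \<mu>_def power2_eq_square field_simps)
  also have "\<dots> \<le> t * d * (\<Sum>x\<in>S. (m x)\<^sup>2)" using Y2 by simp
  finally have "real (card ?Z) * \<mu>\<^sup>2 * (n\<^sup>2 / d) \<le> t * d * (\<Sum>x\<in>S. (m x)\<^sup>2) * (n\<^sup>2 / d)"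
    using n d(1) by (intro mult_right_mono) auto
  then show ?thesis
    using n d(1) by (simp add: \<mu>_def power2_eq_square M_def[symmetric] n_def[symmetric] field_simps)
qed

section \<open>Subspaces through one or two vectors\<close>

context finite_vectorspace
begin

lemma card_subspaces_of_dim:
  assumes "k \<le> dim"
  shows "real (card (subspaces_of_dim K V k)) = (\<Prod>i<k. (real q ^ dim - real q ^ i) / (real q ^ k - real q ^ i))"
proof -
  have "between {\<zero>\<^bsub>V\<^esub>} (carrier V) k = subspaces_of_dim K V k"
    using subspace_zero subspace_subset by (auto simp: between_def subspaces_of_dim_def)
  moreover have "{\<zero>\<^bsub>V\<^esub>} \<in> subspaces_of_dim K V 0" "carrier V \<in> subspaces_of_dim K V dim"
    using subspace_zero_space subspace_carrier card_carrier by (auto simp: subspaces_of_dim_iff_card)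
  ultimately show ?thesis
    using card_between[of "carrier V" dim "{\<zero>\<^bsub>V\<^esub>}" 0 k] by (simp add: atLeast0LessThan)
qed

lemma card_subspaces_of_dim_qbinomial:
  "k \<le> dim \<Longrightarrow> real (card (subspaces_of_dim K V k)) = qbinomial q dim k"
  by (simp add: card_subspaces_of_dim qbinomial_def)

lemma card_subspaces_of_dim_pos:
  assumes "k \<le> dim"
  shows "card (subspaces_of_dim K V k) > 0"
proof -
  have "real q ^ i < real q ^ k" "real q ^ i < real q ^ dim" if "i < k" for i
    using that assms two_le_q by simp_all
  then have "0 < real (card (subspaces_of_dim K V k))"
    unfolding card_subspaces_of_dim[OF assms] by (intro prod_pos) auto
  then show ?thesis by simp
qed

lemma finite_subspaces_of_dim: "finite (subspaces_of_dim K V k)"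
  by (rule finite_subset[OF _ finite_subspaces]) (auto simp: subspaces_of_dim_def)

text \<open>The span of a single vector; it is a line only when \<open>x\<close> is nonzero.\<close>

definition line :: "'b \<Rightarrow> 'b set" where
  "line x = adjoin {\<zero>\<^bsub>V\<^esub>} x"

lemma line_subset_iff: "x \<in> carrier V \<Longrightarrow> subspace K W V \<Longrightarrow> line x \<subseteq> W \<longleftrightarrow> x \<in> W"
  using adjoin_subset_iff[OF subspace_zero_space, of x W] subspace_zero by (auto simp: line_def)

lemma subspace_line: "x \<in> carrier V \<Longrightarrow> subspace K (line x) V"
  by (simp add: line_def subspace_adjoin subspace_zero_space)

lemma card_line: "x \<in> carrier V \<Longrightarrow> x \<noteq> \<zero>\<^bsub>V\<^esub> \<Longrightarrow> card (line x) = q"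
  by (simp add: line_def card_adjoin subspace_zero_space)

lemma line_eq:
  assumes "x \<in> carrier V" "y \<in> line x" "y \<noteq> \<zero>\<^bsub>V\<^esub>"
  shows "line y = line x"
proof -
  have y: "y \<in> carrier V" using assms subspace_subset[OF subspace_line] by blast
  have "x \<noteq> \<zero>\<^bsub>V\<^esub>"
    using assms line_subset_iff[of "\<zero>\<^bsub>V\<^esub>" "{\<zero>\<^bsub>V\<^esub>}"] subspace_zero_space by auto
  then show ?thesis
    using card_subset_eq[of "line x" "line y"] assms y
    by (simp add: line_subset_iff subspace_line card_line subspace_finite)
qed

text \<open>The factors of the \<open>q\<close>-binomial coefficient that counts all \<open>k\<close>-dimensional subspaces.\<close>

abbreviation ratio :: "nat \<Rightarrow> nat \<Rightarrow> real" where
  "ratio k i \<equiv> (real q ^ dim - real q ^ i) / (real q ^ k - real q ^ i)"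

lemma card_subspaces_containing:
  assumes x: "x \<in> carrier V" "x \<noteq> \<zero>\<^bsub>V\<^esub>" and k: "1 \<le> k"
  shows "real (card {W \<in> subspaces_of_dim K V k. x \<in> W}) = (\<Prod>i\<in>{1..<k}. ratio k i)"
proof -
  have "{W \<in> subspaces_of_dim K V k. x \<in> W} = between (line x) (carrier V) k"
    using line_subset_iff[OF x(1)] subspace_subset by (auto simp: between_def subspaces_of_dim_def)
  moreover have "line x \<in> subspaces_of_dim K V 1" "carrier V \<in> subspaces_of_dim K V dim"
    using subspace_line subspace_carrier card_carrier card_line x by (auto simp: subspaces_of_dim_iff_card)
  ultimately show ?thesis
    using card_between[of "carrier V" dim "line x" 1 k] subspace_subset[OF subspace_line[OF x(1)]] k by simp
qed

lemma card_subspaces_containing_pair: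
  assumes x: "x \<in> carrier V" "x \<noteq> \<zero>\<^bsub>V\<^esub>" and y: "y \<in> carrier V" "y \<notin> line x" and k: "2 \<le> k"
  shows "real (card {W \<in> subspaces_of_dim K V k. x \<in> W \<and> y \<in> W}) = (\<Prod>i\<in>{2..<k}. ratio k i)"
proof -
  let ?P = "adjoin (line x) y"
  have l: "subspace K (line x) V" using x by (simp add: subspace_line)
  have P: "subspace K ?P V" "card ?P = q ^ 2"
    using subspace_adjoin[OF l y(1)] card_adjoin[OF l y] card_line[OF x] by (simp_all add: power2_eq_square)
  have "{W \<in> subspaces_of_dim K V k. x \<in> W \<and> y \<in> W} = between ?P (carrier V) k"
    using adjoin_subset_iff[OF l y(1)] line_subset_iff[OF x(1)] subspace_subset
    by (auto simp: between_def subspaces_of_dim_def)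
  moreover have "?P \<in> subspaces_of_dim K V 2" "carrier V \<in> subspaces_of_dim K V dim"
    using P subspace_carrier card_carrier by (auto simp: subspaces_of_dim_iff_card)
  ultimately show ?thesis
    using card_between[of "carrier V" dim ?P 2 k] subspace_subset[OF P(1)] k by simp
qed

lemma no_line_containing_pair:
  assumes "x \<in> carrier V" "x \<noteq> \<zero>\<^bsub>V\<^esub>" "y \<in> carrier V" "y \<notin> line x"
  shows "{W \<in> subspaces_of_dim K V 1. x \<in> W \<and> y \<in> W} = {}"
proof -
  have False if W: "subspace K W V" "card W = q" "x \<in> W" "y \<in> W" for W
  proof -
    have "line x \<subseteq> W" using W assms line_subset_iff by blast
    then have "line x = W" using W card_line assms subspace_finite by (simp add: card_subset_eq)
    then show False using W assms by simp
  qed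
  then show ?thesis by (auto simp: subspaces_of_dim_iff_card)
qed

lemma card_subspaces_containing_pos:
  assumes "1 \<le> k" "k \<le> dim"
  shows "0 < (\<Prod>i\<in>{1..<k}. ratio k i)"
  using assms two_le_q by (intro prod_pos) auto

lemma card_subspaces_split:
  assumes "1 \<le> k" "k \<le> dim"
  shows "real (card (subspaces_of_dim K V k)) = ratio k 0 * (\<Prod>i\<in>{1..<k}. ratio k i)"
proof -
  have "(\<Prod>i<k. ratio k i) = ratio k 0 * (\<Prod>i\<in>{Suc 0..<k}. ratio k i)"
    using assms by (simp add: prod.atLeast_Suc_lessThan flip: atLeast0LessThan)
  then show ?thesis using card_subspaces_of_dim[of k] assms by simp
qed

text \<open>
  With \<open>r i = ratio k i\<close>, the three counts are the products of \<open>r i\<close> over \<open>2 \<le> i < k\<close>, over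
  \<open>0 \<le> i < k\<close> and over \<open>1 \<le> i < k\<close>, so for \<open>k \<ge> 2\<close> the claim amounts to \<open>r 0 \<le> r 1\<close>.
\<close>

lemma pair_negatively_correlated:
  assumes x: "x \<in> carrier V" "x \<noteq> \<zero>\<^bsub>V\<^esub>" and y: "y \<in> carrier V" "y \<notin> line x"
    and k: "1 \<le> k" "k \<le> dim"
  shows "real (card {W \<in> subspaces_of_dim K V k. x \<in> W \<and> y \<in> W}) * real (card (subspaces_of_dim K V k))
    \<le> (\<Prod>i\<in>{1..<k}. ratio k i)\<^sup>2"
proof (cases "k = 1")
  case True
  then show ?thesis
    unfolding True no_line_containing_pair[OF x y] by simp
next
  case False
  then have k2: "2 \<le> k" using k by simp
  define D where "D = (\<Prod>i\<in>{1..<k}. ratio k i)"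
  define D2 where "D2 = (\<Prod>i\<in>{2..<k}. ratio k i)"
  have D: "D = ratio k 1 * D2"
    using k2 by (simp add: D_def D2_def prod.atLeast_Suc_lessThan numeral_2_eq_2)
  have Dpos: "D > 0" using card_subspaces_containing_pos k by (simp add: D_def)
  have lt: "1 < real q ^ k" "real q < real q ^ k"
    using two_le_q k2 power_strict_increasing[of 1 k "real q"] by simp_all
  have le: "real q ^ k \<le> real q ^ dim" using two_le_q k by (intro power_increasing) auto
  have "real q < real q ^ dim" using lt(2) le by (rule less_le_trans)
  then have "ratio k 1 > 0" using lt by (intro divide_pos_pos) simp_all
  moreover have "0 < ratio k 1 * D2" using Dpos D by simp
  ultimately have D2pos: "D2 > 0" by (metis zero_less_mult_pos)
  have "0 \<le> (real q ^ dim - real q ^ k) * (real q - 1)" using le two_le_q by simp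
  then have c: "ratio k 0 \<le> ratio k 1"
    using lt by (simp add: divide_simps) (simp add: algebra_simps)
  have "D2 * (ratio k 0 * D) \<le> D2 * (ratio k 1 * D)"
    using c D2pos Dpos by (intro mult_left_mono mult_right_mono) auto
  also have "\<dots> = D\<^sup>2" by (simp add: D power2_eq_square)
  finally show ?thesis
    using card_subspaces_containing_pair[OF x y k2] card_subspaces_split[OF k]
    by (simp add: D_def D2_def)
qed

lemma ratio_0_bounds:
  assumes k: "1 \<le> k" "k \<le> dim"
  shows "real q ^ (dim - k) \<le> ratio k 0" "ratio k 0 \<le> 2 * real q ^ (dim - k)"
proof -
  have e: "real q ^ dim = real q ^ (dim - k) * real q ^ k"
    using k by (simp flip: power_add)
  have "real q ^ 1 \<le> real q ^ k"
    using two_le_q k by (intro power_increasing) auto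
  moreover have "2 \<le> real q" using two_le_q by simp
  ultimately have q2: "2 \<le> real q ^ k" unfolding power_one_right by linarith
  have s1: "1 \<le> real q ^ (dim - k)" using two_le_q by simp
  show "real q ^ (dim - k) \<le> ratio k 0"
    unfolding e using q2 s1 by (simp add: pos_le_divide_eq algebra_simps)
  have "real q ^ (dim - k) * 2 \<le> real q ^ (dim - k) * real q ^ k"
    using q2 s1 by (intro mult_left_mono) auto
  then show "ratio k 0 \<le> 2 * real q ^ (dim - k)"
    unfolding e using q2 s1 by (simp add: pos_divide_le_eq algebra_simps)
qed

text \<open>
  The second moment bound for the nonzero vectors covered by \<open>\<A>\<close>. The classes of proportional
  vectors are the lines, which have \<open>q\<close> elements with the zero vector included. The hypothesis on
  \<open>m\<close> says that \<open>m x\<close> depends only on which members of \<open>\<A>\<close> contain \<open>x\<close>.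
\<close>

lemma distinguishing_subspaces_bound:
  fixes m :: "'b \<Rightarrow> real"
  assumes \<A>: "\<And>A. A \<in> \<A> \<Longrightarrow> subspace K A V" and k: "1 \<le> k" "k \<le> dim"
    and m: "\<And>x. 0 \<le> m x" "\<And>x y. (\<And>A. A \<in> \<A> \<Longrightarrow> x \<in> A \<longleftrightarrow> y \<in> A) \<Longrightarrow> m x = m y"
  defines "S \<equiv> \<Union>\<A> - {\<zero>\<^bsub>V\<^esub>}"
  shows "real (card (distinguishing_subspaces K V k \<A>)) * (sum m S)\<^sup>2
    \<le> real (card (subspaces_of_dim K V k)) * (2 * real q ^ (dim - k + 1)) * (\<Sum>x\<in>S. (m x)\<^sup>2)"
proof -
  let ?\<Omega> = "subspaces_of_dim K V k"
  define D where "D = (\<Prod>i\<in>{1..<k}. ratio k i)"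
  have Dpos: "D > 0" using card_subspaces_containing_pos k by (simp add: D_def)
  have Sc: "x \<in> carrier V \<and> x \<noteq> \<zero>\<^bsub>V\<^esub>" if "x \<in> S" for x
    using that \<A> subspace_subset by (auto simp: S_def)
  have finS: "finite S" using Sc finite_vectors by (auto intro: finite_subset)
  have "real (card {W \<in> ?\<Omega>. \<forall>x\<in>S. x \<notin> W}) * D * (sum m S)\<^sup>2
      \<le> (real (card ?\<Omega>))\<^sup>2 * real q * (\<Sum>x\<in>S. (m x)\<^sup>2)"
  proof (rule weighted_second_moment[where E = "\<lambda>x y. y \<in> line x"])
    show "finite ?\<Omega>" by (rule finite_subspaces_of_dim)
    show "finite S" by (rule finS)
    show "?\<Omega> \<noteq> {}" using card_subspaces_of_dim_pos[OF k(2)] by auto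
    show "0 < D" by (rule Dpos)
    show "real (card {W \<in> ?\<Omega>. x \<in> W}) = D" if "x \<in> S" for x
      using card_subspaces_containing Sc[OF that] k by (simp add: D_def)
    show "real (card {W \<in> ?\<Omega>. x \<in> W \<and> y \<in> W}) * real (card ?\<Omega>) \<le> D\<^sup>2"
      if "x \<in> S" "y \<in> S" "y \<notin> line x" for x y
      using pair_negatively_correlated Sc that k by (simp add: D_def)
    show "real (card {y \<in> S. y \<in> line x}) \<le> real q" if "x \<in> S" for x
    proof -
      have "card {y \<in> S. y \<in> line x} \<le> card (line x)"
        using Sc[OF that] by (intro card_mono) (auto simp: subspace_finite subspace_line)
      then show ?thesis using card_line Sc[OF that] by simp
    qed
    show "0 \<le> m x" for x by (rule m(1))
    show "m y = m x" if "x \<in> S" "y \<in> S" "y \<in> line x" for x y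
    proof (rule m(2))
      fix A assume "A \<in> \<A>"
      then show "y \<in> A \<longleftrightarrow> x \<in> A"
        using line_subset_iff[of x A] line_subset_iff[of y A] line_eq[of x y] Sc that \<A> by simp
    qed
  qed
  moreover have "distinguishing_subspaces K V k \<A> = {W \<in> ?\<Omega>. \<forall>x\<in>S. x \<notin> W}"
  proof -
    have "distinguishes V W A \<longleftrightarrow> (\<forall>x\<in>A - {\<zero>\<^bsub>V\<^esub>}. x \<notin> W)" if "W \<in> ?\<Omega>" "A \<in> \<A>" for W A
      using subspace_zero[of W] subspace_zero[OF \<A>[OF that(2)]] that
      by (auto simp: distinguishes_def subspaces_of_dim_def)
    then show ?thesis by (auto simp: distinguishing_subspaces_def S_def)
  qed
  moreover have "real (card ?\<Omega>) \<le> 2 * real q ^ (dim - k) * D"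
    unfolding card_subspaces_split[OF k] D_def[symmetric]
    using ratio_0_bounds(2)[OF k] Dpos by (intro mult_right_mono) auto
  then have "(real (card ?\<Omega>))\<^sup>2 * real q * (\<Sum>x\<in>S. (m x)\<^sup>2)
      \<le> real (card ?\<Omega>) * (2 * real q ^ (dim - k) * D) * real q * (\<Sum>x\<in>S. (m x)\<^sup>2)"
    unfolding power2_eq_square[of "real (card ?\<Omega>)"]
    by (intro mult_right_mono mult_left_mono) (auto intro: sum_nonneg)
  ultimately have "(real (card (distinguishing_subspaces K V k \<A>)) * (sum m S)\<^sup>2) * D
      \<le> (real (card ?\<Omega>) * (2 * real q ^ (dim - k + 1)) * (\<Sum>x\<in>S. (m x)\<^sup>2)) * D"
    by (simp add: mult_ac)
  then show ?thesis using Dpos by (simp only: mult_le_cancel_right_pos)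
qed

end

section \<open>Inequalities for q-binomial coefficients\<close>

text \<open>
  Factor by factor: with \<open>u = q^n\<close> and \<open>x = q^i\<close>,
  \<open>(q u - x)^2 - (u - x) (q^2 u - x) = u x (q - 1)^2\<close>.
\<close>

lemma qbinomial_log_concave:
  assumes q: "2 \<le> q" and k: "k \<le> n + 1"
  shows "qbinomial q n k * qbinomial q (n + 2) k \<le> (qbinomial q (n + 1) k)\<^sup>2"
  unfolding qbinomial_def power2_eq_square prod.distrib[symmetric]
proof (intro prod_mono conjI)
  fix i assume "i \<in> {..<k}"
  then have i: "i < k" "i \<le> n" using k by auto
  define u where "u = real q ^ n"
  define x where "x = real q ^ i"
  define e where "e = real q ^ k - x"
  have r: "2 \<le> real q" using q by simp
  have "x < real q ^ k" unfolding x_def using r i by (intro power_strict_increasing) auto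
  then have e: "e > 0" by (simp add: e_def)
  have x: "0 \<le> x" "x \<le> u" unfolding x_def u_def using r i by (auto intro: power_increasing)
  have pw: "real q ^ (n + 1) = real q * u" "real q ^ (n + 2) = real q * (real q * u)"
    by (simp_all add: u_def)
  have "u \<le> real q ^ (n + 2)" unfolding u_def using r by (intro power_increasing) auto
  then show "0 \<le> (real q ^ n - real q ^ i) / (real q ^ k - real q ^ i) *
      ((real q ^ (n + 2) - real q ^ i) / (real q ^ k - real q ^ i))"
    using x e unfolding u_def[symmetric] x_def[symmetric] e_def[symmetric]
    by (intro mult_nonneg_nonneg divide_nonneg_pos) auto
  have "0 \<le> u * x * (real q - 1)\<^sup>2" using x by simp
  then have "(u - x) * (real q * (real q * u) - x) \<le> (real q * u - x) * (real q * u - x)"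
    by (simp add: algebra_simps power2_eq_square)
  then have "(u - x) * (real q * (real q * u) - x) / (e * e) \<le> (real q * u - x) * (real q * u - x) / (e * e)"
    using e by (intro divide_right_mono) auto
  then show "(real q ^ n - real q ^ i) / (real q ^ k - real q ^ i) *
        ((real q ^ (n + 2) - real q ^ i) / (real q ^ k - real q ^ i))
      \<le> (real q ^ (n + 1) - real q ^ i) / (real q ^ k - real q ^ i) *
        ((real q ^ (n + 1) - real q ^ i) / (real q ^ k - real q ^ i))"
    unfolding pw u_def[symmetric] x_def[symmetric] e_def[symmetric] times_divide_times_eq .
qed

lemma qbinomial_Suc_le:
  assumes q: "2 \<le> q" and k: "k \<le> n + 1"
  shows "qbinomial q (n + 2) k \<le> (2 * real q) ^ k * qbinomial q (n + 1) k"
proof -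
  have "qbinomial q (n + 2) k
      \<le> (\<Prod>i<k. 2 * real q * ((real q ^ (n + 1) - real q ^ i) / (real q ^ k - real q ^ i)))"
    unfolding qbinomial_def
  proof (intro prod_mono conjI)
    fix i assume "i \<in> {..<k}"
    then have i: "i < k" "i \<le> n" using k by auto
    define u where "u = real q ^ n"
    define x where "x = real q ^ i"
    have r: "2 \<le> real q" using q by simp
    have e: "0 < real q ^ k - x" unfolding x_def using r i by simp
    have x: "0 \<le> x" "x \<le> u" unfolding x_def u_def using r i by (auto intro: power_increasing)
    have pw: "real q ^ (n + 1) = real q * u" "real q ^ (n + 2) = real q * (real q * u)"
      by (simp_all add: u_def)
    have "u \<le> real q ^ (n + 2)" unfolding u_def using r by (intro power_increasing) auto
    then show "0 \<le> (real q ^ (n + 2) - real q ^ i) / (real q ^ k - real q ^ i)"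
      unfolding x_def[symmetric] using x e by (intro divide_nonneg_pos) auto
    have "real q * (2 * x) \<le> real q * (real q * u)"
      using r x by (intro mult_left_mono mult_mono) auto
    then have "real q ^ (n + 2) - x \<le> 2 * real q * (real q ^ (n + 1) - x)"
      unfolding pw using x by (simp add: algebra_simps)
    then have "(real q ^ (n + 2) - x) / (real q ^ k - x) \<le> 2 * real q * (real q ^ (n + 1) - x) / (real q ^ k - x)"
      using e by (intro divide_right_mono) auto
    then show "(real q ^ (n + 2) - real q ^ i) / (real q ^ k - real q ^ i)
        \<le> 2 * real q * ((real q ^ (n + 1) - real q ^ i) / (real q ^ k - real q ^ i))"
      unfolding x_def[symmetric] times_divide_eq_right .
  qed
  also have "\<dots> = (2 * real q) ^ k * qbinomial q (n + 1) k"
    unfolding prod.distrib by (simp add: qbinomial_def power_mult_distrib)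
  finally show ?thesis .
qed

lemma qbinomial_pos:
  assumes "2 \<le> q" "k \<le> n"
  shows "0 < qbinomial q n k"
  unfolding qbinomial_def
proof (intro prod_pos divide_pos_pos)
  fix i assume "i \<in> {..<k}"
  then show "0 < real q ^ n - real q ^ i" "0 < real q ^ k - real q ^ i" using assms by auto
qed

section \<open>Bounds for intersecting and distinguishing subspaces\<close>

context finite_vectorspace
begin

lemma finite_family: "\<A> \<subseteq> subspaces_of_dim K V d \<Longrightarrow> finite \<A>"
  using finite_subspaces_of_dim finite_subset by blast

lemma card_intersecting_subspaces_le:
  assumes \<A>: "\<A> \<subseteq> subspaces_of_dim K V (dim - k)" and k: "1 \<le> k" "k \<le> dim"
  shows "real (card (intersecting_subspaces K V k \<A>))
    \<le> real (card (subspaces_of_dim K V k)) * (2 * (real (card \<A>) / real q))"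
proof -
  let ?\<Omega> = "subspaces_of_dim K V k"
  define D where "D = (\<Prod>i\<in>{1..<k}. ratio k i)"
  have Dpos: "D > 0" using card_subspaces_containing_pos k by (simp add: D_def)
  have one: "real (card {W \<in> ?\<Omega>. intersects V W A}) \<le> real (card ?\<Omega>) * (2 / real q)"
    if "A \<in> \<A>" for A
  proof -
    have A: "subspace K A V" "card A = q ^ (dim - k)"
      using that \<A> subspaces_of_dim_iff_card by auto
    let ?F = "{W \<in> ?\<Omega>. intersects V W A}"
    let ?S = "A - {\<zero>\<^bsub>V\<^esub>}"
    have finS: "finite ?S" using subspace_finite[OF A(1)] by simp
    have many: "q - 1 \<le> card {x \<in> ?S. x \<in> W}" if WF: "W \<in> ?F" for W
    proof -
      have W: "subspace K W V" using WF by (simp add: subspaces_of_dim_def)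
      have "\<zero>\<^bsub>V\<^esub> \<in> W \<inter> A" using subspace_zero W A by blast
      then obtain x where x: "x \<in> W" "x \<in> A" "x \<noteq> \<zero>\<^bsub>V\<^esub>"
        using WF by (auto simp: distinguishes_def)
      have xc: "x \<in> carrier V" using x subspace_subset[OF W] by auto
      have "line x - {\<zero>\<^bsub>V\<^esub>} \<subseteq> {x \<in> ?S. x \<in> W}"
        using line_subset_iff[OF xc W] line_subset_iff[OF xc A(1)] x by auto
      then have "card (line x - {\<zero>\<^bsub>V\<^esub>}) \<le> card {x \<in> ?S. x \<in> W}"
        using finS by (intro card_mono) auto
      then show ?thesis
        using card_line[OF xc x(3)] subspace_zero[OF subspace_line[OF xc]] by simp
    qed
    have "card ?F * (q - 1) = (\<Sum>W\<in>?F. q - 1)" by simp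
    also have "\<dots> \<le> (\<Sum>W\<in>?F. card {x \<in> ?S. x \<in> W})"
      using many by (rule sum_mono)
    also have "\<dots> \<le> (\<Sum>W\<in>?\<Omega>. card {x \<in> ?S. x \<in> W})"
      using finite_subspaces_of_dim by (intro sum_mono2) auto
    also have "\<dots> = (\<Sum>x\<in>?S. card {W \<in> ?\<Omega>. x \<in> W})"
      by (rule sum_multicount_gen[symmetric]) (use finS finite_subspaces_of_dim in auto)
    finally have "real (card ?F * (q - 1)) \<le> (\<Sum>x\<in>?S. real (card {W \<in> ?\<Omega>. x \<in> W}))"
      by (simp only: of_nat_le_iff flip: of_nat_sum)
    also have "\<dots> = (\<Sum>x\<in>?S. D)"
    proof (rule sum.cong)
      fix x assume "x \<in> ?S"
      then show "real (card {W \<in> ?\<Omega>. x \<in> W}) = D"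
        using card_subspaces_containing[of x k] subspace_subset[OF A(1)] k by (auto simp: D_def)
    qed simp
    also have "\<dots> \<le> real q ^ (dim - k) * D"
      using Dpos A(2) card_Diff1_le[of A "\<zero>\<^bsub>V\<^esub>"] by (simp add: mult_right_mono flip: of_nat_power)
    also have "\<dots> \<le> real (card ?\<Omega>)"
      unfolding card_subspaces_split[OF k] D_def[symmetric]
      using ratio_0_bounds(1)[OF k] Dpos by (intro mult_right_mono) auto
    finally have *: "real (card ?F) * real (q - 1) \<le> real (card ?\<Omega>)" by simp
    have "real (card ?F) * real q \<le> real (card ?F) * (2 * real (q - 1))"
      using two_le_q by (intro mult_left_mono) auto
    then have "real (card ?F) * real q \<le> real (card ?\<Omega>) * 2" using * by simp
    then show ?thesis using two_le_q by (simp add: pos_le_divide_eq)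
  qed
  have "intersecting_subspaces K V k \<A> = (\<Union>A\<in>\<A>. {W \<in> ?\<Omega>. intersects V W A})"
    by (auto simp: intersecting_subspaces_def)
  then have "card (intersecting_subspaces K V k \<A>) \<le> (\<Sum>A\<in>\<A>. card {W \<in> ?\<Omega>. intersects V W A})"
    using card_UN_le[OF finite_family[OF \<A>]] by simp
  then have "real (card (intersecting_subspaces K V k \<A>)) \<le> (\<Sum>A\<in>\<A>. real (card {W \<in> ?\<Omega>. intersects V W A}))"
    by (simp only: of_nat_le_iff flip: of_nat_sum)
  also have "\<dots> \<le> (\<Sum>A\<in>\<A>. real (card ?\<Omega>) * (2 / real q))"
    using one by (rule sum_mono)
  finally show ?thesis by (simp add: mult_ac)
qed

text \<open>The case \<open>m = 1\<close>.\<close>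

lemma card_distinguishing_le_Union:
  assumes \<A>: "\<And>A. A \<in> \<A> \<Longrightarrow> subspace K A V" and k: "1 \<le> k" "k \<le> dim"
  shows "real (card (distinguishing_subspaces K V k \<A>)) * real (card (\<Union>\<A> - {\<zero>\<^bsub>V\<^esub>}))
    \<le> real (card (subspaces_of_dim K V k)) * (2 * real q ^ (dim - k + 1))"
proof (cases "card (\<Union>\<A> - {\<zero>\<^bsub>V\<^esub>}) = 0")
  case False
  then have pos: "0 < real (card (\<Union>\<A> - {\<zero>\<^bsub>V\<^esub>}))" by simp
  have "real (card (distinguishing_subspaces K V k \<A>)) * (real (card (\<Union>\<A> - {\<zero>\<^bsub>V\<^esub>})))\<^sup>2
    \<le> real (card (subspaces_of_dim K V k)) * (2 * real q ^ (dim - k + 1)) * real (card (\<Union>\<A> - {\<zero>\<^bsub>V\<^esub>}))"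
    using distinguishing_subspaces_bound[OF \<A> k, of \<A> "\<lambda>_. 1"] by simp
  then show ?thesis
    using pos unfolding power2_eq_square mult.assoc[symmetric] by (simp only: mult_le_cancel_right_pos)
qed simp

text \<open>
  Here \<open>m x\<close> is the number of members of \<open>\<A>\<close> that contain \<open>x\<close>. The zero vector is left out of
  every count, which is where \<open>q^l - 1\<close> comes from; it vanishes for \<open>l = 0\<close>.
\<close>

lemma card_distinguishing_le_Int:
  assumes \<A>: "\<A> \<subseteq> subspaces_of_dim K V (dim - k)" "\<A> \<noteq> {}" and k: "1 \<le> k" "k < dim"
    and l: "\<And>A B. A \<in> \<A> \<Longrightarrow> B \<in> \<A> \<Longrightarrow> A \<noteq> B \<Longrightarrow> card (A \<inter> B) \<le> q ^ l"
  shows "real (card (distinguishing_subspaces K V k \<A>))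
    \<le> real (card (subspaces_of_dim K V k)) *
        (8 * (real q / real (card \<A>) + real q / real q ^ (dim - k) * (real q ^ l - 1)))"
proof -
  let ?S = "\<Union>\<A> - {\<zero>\<^bsub>V\<^esub>}"
  define s where "s = dim - k"
  define a where "a = real (card \<A>)"
  define Z where "Z = real (card (distinguishing_subspaces K V k \<A>))"
  define n where "n = real (card (subspaces_of_dim K V k))"
  have fin\<A>: "finite \<A>" using finite_family[OF \<A>(1)] .
  have a: "a \<ge> 1" using fin\<A> \<A>(2) by (simp add: a_def card_gt_0_iff Suc_leI)
  have As: "subspace K A V \<and> card A = q ^ s \<and> finite A \<and> \<zero>\<^bsub>V\<^esub> \<in> A" if "A \<in> \<A>" for A
    using that \<A> subspaces_of_dim_iff_card subspace_finite subspace_zero by (auto simp: s_def)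
  have finS: "finite ?S" using As fin\<A> by auto
  define m where "m x = real (card {A \<in> \<A>. x \<in> A})" for x
  have m_sum: "m x = (\<Sum>A\<in>\<A>. of_bool (x \<in> A))" for x
    using fin\<A> by (simp add: m_def of_bool_def flip: sum.inter_filter)
  have ind: "(\<Sum>x\<in>?S. of_bool (x \<in> B)) = real (card (B - {\<zero>\<^bsub>V\<^esub>}))" if "B \<subseteq> \<Union>\<A>" for B
  proof -
    have "{x \<in> ?S. x \<in> B} = B - {\<zero>\<^bsub>V\<^esub>}" using that by auto
    then show ?thesis using finS by (simp add: of_bool_def flip: sum.inter_filter)
  qed
  have M: "sum m ?S = a * (real q ^ s - 1)"
  proof -
    have "sum m ?S = (\<Sum>A\<in>\<A>. \<Sum>x\<in>?S. of_bool (x \<in> A))"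
      unfolding m_sum by (rule sum.swap)
    also have "\<dots> = (\<Sum>A\<in>\<A>. real q ^ s - 1)"
    proof (rule sum.cong)
      fix A assume A: "A \<in> \<A>"
      have "(\<Sum>x\<in>?S. of_bool (x \<in> A)) = real (card (A - {\<zero>\<^bsub>V\<^esub>}))" using A by (intro ind) auto
      then show "(\<Sum>x\<in>?S. of_bool (x \<in> A)) = real q ^ s - 1"
        using As[OF A] two_le_q by (simp add: of_nat_diff)
    qed simp
    finally show ?thesis by (simp add: a_def)
  qed
  have Q: "(\<Sum>x\<in>?S. (m x)\<^sup>2) \<le> a * (real q ^ s - 1) + a\<^sup>2 * (real q ^ l - 1)"
  proof -
    have "(\<Sum>x\<in>?S. (m x)\<^sup>2) = (\<Sum>x\<in>?S. \<Sum>A\<in>\<A>. \<Sum>B\<in>\<A>. of_bool (x \<in> A \<inter> B))"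
      unfolding m_sum power2_eq_square sum_product by (intro sum.cong refl) auto
    also have "\<dots> = (\<Sum>A\<in>\<A>. \<Sum>x\<in>?S. \<Sum>B\<in>\<A>. of_bool (x \<in> A \<inter> B))" by (rule sum.swap)
    also have "\<dots> = (\<Sum>A\<in>\<A>. \<Sum>B\<in>\<A>. \<Sum>x\<in>?S. of_bool (x \<in> A \<inter> B))"
      by (intro sum.cong refl sum.swap)
    also have "\<dots> \<le> (\<Sum>A\<in>\<A>. \<Sum>B\<in>\<A>. (if A = B then real q ^ s - 1 else 0) + (real q ^ l - 1))"
    proof (intro sum_mono)
      fix A B assume AB: "A \<in> \<A>" "B \<in> \<A>"
      have "(\<Sum>x\<in>?S. of_bool (x \<in> A \<inter> B)) = real (card (A \<inter> B - {\<zero>\<^bsub>V\<^esub>}))"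
        using AB by (intro ind) auto
      also have "\<dots> = real (card (A \<inter> B)) - 1"
      proof -
        have "\<zero>\<^bsub>V\<^esub> \<in> A \<inter> B" "finite (A \<inter> B)" using As AB by auto
        moreover from this have "1 \<le> card (A \<inter> B)" by (metis One_nat_def Suc_leI card_gt_0_iff empty_iff)
        ultimately show ?thesis by (simp add: of_nat_diff)
      qed
      also have "\<dots> \<le> (if A = B then real q ^ s - 1 else 0) + (real q ^ l - 1)"
      proof (cases "A = B")
        case True
        have "1 \<le> real q ^ l" using two_le_q by simp
        then show ?thesis using As[OF AB(1)] True by simp
      next
        case False
        have "real (card (A \<inter> B)) \<le> real (q ^ l)" using l[OF AB False] by (simp only: of_nat_le_iff)
        then show ?thesis using False by simp
      qed
      finally show "(\<Sum>x\<in>?S. of_bool (x \<in> A \<inter> B)) \<le> (if A = B then real q ^ s - 1 else 0) + (real q ^ l - 1)" .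
    qed
    also have "\<dots> = a * (real q ^ s - 1) + a\<^sup>2 * (real q ^ l - 1)"
      using fin\<A> by (simp add: sum.distrib a_def power2_eq_square distrib_left)
    finally show ?thesis .
  qed
  have "Z * (sum m ?S)\<^sup>2 \<le> n * (2 * real q ^ (s + 1)) * (\<Sum>x\<in>?S. (m x)\<^sup>2)"
    unfolding Z_def n_def s_def
  proof (rule distinguishing_subspaces_bound)
    show "m x = m y" if "\<And>A. A \<in> \<A> \<Longrightarrow> x \<in> A \<longleftrightarrow> y \<in> A" for x y
      using that by (auto simp: m_def intro!: arg_cong[where f = card])
  qed (use As k in \<open>auto simp: m_def\<close>)
  also have "\<dots> \<le> n * (2 * real q ^ (s + 1)) * (a * (real q ^ s - 1) + a\<^sup>2 * (real q ^ l - 1))"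
    using Q by (intro mult_left_mono) (auto simp: n_def)
  finally have main: "Z * (a * (real q ^ s - 1))\<^sup>2
      \<le> n * (2 * real q ^ (s + 1)) * (a * (real q ^ s - 1) + a\<^sup>2 * (real q ^ l - 1))"
    by (simp add: M)
  \<comment> \<open>It remains to simplify the bound, using \<open>T \<le> 2 (T - 1)\<close> for \<open>T = q^s \<ge> 2\<close>.\<close>
  define T where "T = real q ^ s"
  define u where "u = real q ^ l - 1"
  have "real q ^ 1 \<le> T" unfolding T_def using two_le_q k by (intro power_increasing) (auto simp: s_def)
  moreover have "2 \<le> real q" using two_le_q by simp
  ultimately have T: "2 \<le> T" unfolding power_one_right by linarith
  have u: "0 \<le> u" using two_le_q by (simp add: u_def)
  have n: "0 \<le> n" by (simp add: n_def)
  have "Z \<le> n * (2 * real q * T) * (a * (T - 1) + a\<^sup>2 * u) / (a * (T - 1))\<^sup>2"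
    using main a T by (simp add: pos_le_divide_eq T_def u_def mult_ac)
  also have "\<dots> = n * (2 * real q * (T / (a * (T - 1)) + u * T / (T - 1)\<^sup>2))"
  proof -
    have "2 * y * T * (a * w + a\<^sup>2 * u) / (a * w)\<^sup>2 = 2 * y * (T / (a * w) + u * T / w\<^sup>2)"
      if "w > 0" for w y :: real
      using a that by (simp add: field_simps power2_eq_square)
    from this[of "T - 1" "real q"] show ?thesis
      using T by (simp add: mult.assoc flip: times_divide_eq_right)
  qed
  also have "\<dots> \<le> n * (2 * real q * (4 * (1 / a) + 4 * (u / T)))"
  proof (intro mult_left_mono add_mono)
    show "T / (a * (T - 1)) \<le> 4 * (1 / a)"
      using a T by (simp add: divide_simps)
    have "T\<^sup>2 \<le> (2 * (T - 1))\<^sup>2" using T by (intro power_mono) auto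
    then have "T * T \<le> 4 * (T - 1)\<^sup>2" by (simp add: power2_eq_square algebra_simps)
    then have "T / (T - 1)\<^sup>2 \<le> 4 / T" using T by (simp add: divide_simps)
    then have "u * (T / (T - 1)\<^sup>2) \<le> u * (4 / T)" using u by (rule mult_left_mono)
    then show "u * T / (T - 1)\<^sup>2 \<le> 4 * (u / T)" by (simp add: mult_ac)
  qed (use n in auto)
  also have "\<dots> = n * (8 * (real q / a + real q / T * u))" by (simp add: algebra_simps)
  finally show ?thesis by (simp add: Z_def n_def a_def T_def u_def s_def)
qed

section \<open>The dual bound\<close>

lemma card_subspaces_below:
  assumes "T \<in> subspaces_of_dim K V n"
  shows "real (card {W \<in> subspaces_of_dim K V k. W \<subseteq> T}) = qbinomial q n k"
proof -
  have T: "subspace K T V" using assms by (simp add: subspaces_of_dim_def)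
  have "{W \<in> subspaces_of_dim K V k. W \<subseteq> T} = between {\<zero>\<^bsub>V\<^esub>} T k"
    using subspace_zero by (auto simp: between_def subspaces_of_dim_def)
  moreover have "{\<zero>\<^bsub>V\<^esub>} \<in> subspaces_of_dim K V 0"
    using subspace_zero_space by (auto simp: subspaces_of_dim_iff_card)
  ultimately show ?thesis
    using card_between[OF assms, of "{\<zero>\<^bsub>V\<^esub>}" 0 k] subspace_zero[OF T]
    by (simp add: atLeast0LessThan qbinomial_def)
qed

lemma Int_hyperplanes:
  assumes n: "dim = n + 2" and h: "h \<in> subspaces_of_dim K V (n + 1)" "h' \<in> subspaces_of_dim K V (n + 1)"
    and ne: "h \<noteq> h'"
  shows "h \<inter> h' \<in> subspaces_of_dim K V n"
proof -
  have s: "subspace K h V" "subspace K h' V" and c: "card h = q ^ (n + 1)" "card h' = q ^ (n + 1)"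
    using h by (simp_all add: subspaces_of_dim_iff_card)
  have sI: "subspace K (h \<inter> h') V" using s by (rule subspace_Int)
  define e where "e = subspace_dim K V (h \<inter> h')"
  have e: "card (h \<inter> h') = q ^ e" using card_subspace[OF sI] by (simp add: e_def)
  have "card h * card h' \<le> card (carrier V) * card (h \<inter> h')"
    using s by (intro card_mult_le subspace_carrier subspace_subset)
  then have "q ^ (n + 1 + (n + 1)) \<le> q ^ (n + 2 + e)"
    unfolding c e card_carrier n by (simp only: power_add)
  then have "n + 1 + (n + 1) \<le> n + 2 + e" using two_le_q by (simp only: power_increasing_iff)
  moreover have "e < n + 1"
  proof -
    have "\<not> h \<subseteq> h'" using card_subset_eq[OF subspace_finite[OF s(2)], of h] c ne by auto
    then have "card (h \<inter> h') < card h" by (intro psubset_card_mono subspace_finite s) auto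
    then show ?thesis unfolding e c using two_le_q by (simp only: power_strict_increasing_iff)
  qed
  ultimately have "e = n" by simp
  then show ?thesis using sI e by (simp only: subspaces_of_dim_iff_card)
qed

text \<open>The exact number is \<open>(q^k - 1) / (q - 1)\<close>; each of the \<open>k - 1\<close> factors is at least \<open>q\<close>.\<close>

lemma card_hyperplanes_above:
  assumes A: "A \<in> subspaces_of_dim K V (dim - k)" and k: "1 \<le> k" "k \<le> dim"
  shows "real q ^ (k - 1) \<le> real (card (between A (carrier V) (dim - 1)))"
proof -
  have r: "2 \<le> real q" using two_le_q by simp
  have pw: "real q ^ dim = real q * real q ^ (dim - 1)" using k by (simp flip: power_Suc)
  have "real q ^ (k - 1) = (\<Prod>i\<in>{dim - k..<dim - 1}. real q)" using k by simp
  also have "\<dots> \<le> (\<Prod>i\<in>{dim - k..<dim - 1}. ratio (dim - 1) i)"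
  proof (intro prod_mono conjI)
    fix i assume i: "i \<in> {dim - k..<dim - 1}"
    have p: "0 < real q ^ (dim - 1) - real q ^ i" using i r by simp
    have "1 * real q ^ i \<le> real q * real q ^ i" using r by (intro mult_right_mono) auto
    then have "real q * (real q ^ (dim - 1) - real q ^ i) \<le> real q ^ dim - real q ^ i"
      unfolding pw right_diff_distrib by linarith
    then show "real q \<le> ratio (dim - 1) i" using p by (simp only: pos_le_divide_eq)
  qed simp
  also have "\<dots> = real (card (between A (carrier V) (dim - 1)))"
  proof (rule card_between[symmetric])
    show "carrier V \<in> subspaces_of_dim K V dim"
      using subspace_carrier card_carrier by (simp add: subspaces_of_dim_iff_card)
    show "A \<subseteq> carrier V" using A by (simp add: subspaces_of_dim_def subspace_subset)
    show "dim - k \<le> dim - 1" using k by simp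
  qed (fact A)
  finally show ?thesis .
qed

text \<open>The dimension formula as it is used below, with an upper bound for the intersection.\<close>

lemma dim_add_le:
  assumes A: "A \<in> subspaces_of_dim K V a" "B \<in> subspaces_of_dim K V b" "h \<in> subspaces_of_dim K V c"
    and sub: "A \<subseteq> h" "B \<subseteq> h" and l: "card (A \<inter> B) \<le> q ^ l"
  shows "a + b \<le> c + l"
proof -
  have "card A * card B \<le> card h * card (A \<inter> B)"
    using A sub by (intro card_mult_le) (simp_all add: subspaces_of_dim_def)
  also have "\<dots> \<le> card h * q ^ l" using l by (rule mult_le_mono2)
  finally have "q ^ (a + b) \<le> q ^ (c + l)"
    using A by (simp only: subspaces_of_dim_iff_card power_add)
  then show ?thesis using two_le_q by (simp only: power_increasing_iff)
qed

text \<open>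
  The second moment bound for a set \<open>S\<close> of hyperplanes. Negative correlation holds because the
  \<open>q\<close>-binomial coefficient is log-concave in its upper argument.
\<close>

lemma card_not_below_hyperplanes:
  assumes S: "S \<subseteq> subspaces_of_dim K V (dim - 1)" and k: "1 \<le> k" "k < dim"
  shows "real (card {W \<in> subspaces_of_dim K V k. \<forall>h\<in>S. \<not> W \<subseteq> h}) * real (card S)
    \<le> real (card (subspaces_of_dim K V k)) * (2 * real q) ^ k"
proof (cases "card S = 0")
  case False
  let ?\<Omega> = "subspaces_of_dim K V k"
  define Z where "Z = real (card {W \<in> ?\<Omega>. \<forall>h\<in>S. \<not> W \<subseteq> h})"
  define n where "n = dim - 2"
  have n: "dim = n + 2" using k by (simp add: n_def)
  have kn: "k \<le> n + 1" using k n by simp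
  define b where "b j = qbinomial q j k" for j
  have bpos: "0 < b (n + 1)" unfolding b_def using two_le_q kn by (rule qbinomial_pos)
  have \<Omega>: "real (card ?\<Omega>) = b (n + 2)"
    using card_subspaces_of_dim_qbinomial[of k] k n by (simp add: b_def)
  have SH: "h \<in> subspaces_of_dim K V (n + 1)" if "h \<in> S" for h using S that n by auto
  have finS: "finite S" using finite_family[OF S] .
  have "Z * b (n + 1) * (sum (\<lambda>_. 1) S)\<^sup>2 \<le> (real (card ?\<Omega>))\<^sup>2 * 1 * (\<Sum>h\<in>S. 1\<^sup>2)"
    unfolding Z_def
  proof (rule weighted_second_moment[where E = "(=)"])
    show "finite ?\<Omega>" by (rule finite_subspaces_of_dim)
    show "finite S" by (rule finS)
    show "?\<Omega> \<noteq> {}" using card_subspaces_of_dim_pos[of k] k by auto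
    show "0 < b (n + 1)" by (rule bpos)
    show "real (card {W \<in> ?\<Omega>. W \<subseteq> h}) = b (n + 1)" if "h \<in> S" for h
      unfolding b_def by (rule card_subspaces_below) (rule SH[OF that])
    show "real (card {W \<in> ?\<Omega>. W \<subseteq> h \<and> W \<subseteq> h'}) * real (card ?\<Omega>) \<le> (b (n + 1))\<^sup>2"
      if "h \<in> S" "h' \<in> S" "h \<noteq> h'" for h h'
    proof -
      have "real (card {W \<in> ?\<Omega>. W \<subseteq> h \<inter> h'}) = b n"
        unfolding b_def by (rule card_subspaces_below) (rule Int_hyperplanes[OF n SH[OF that(1)] SH[OF that(2)] that(3)])
      then show ?thesis
        using qbinomial_log_concave[OF two_le_q kn] \<Omega> by (simp add: b_def)
    qed
    show "real (card {y \<in> S. x = y}) \<le> 1" if "x \<in> S" for x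
    proof -
      have "{y \<in> S. x = y} = {x}" using that by auto
      then show ?thesis by simp
    qed
    show "(0::real) \<le> 1" by simp
  qed (rule refl)
  then have "Z * b (n + 1) * (real (card S))\<^sup>2 \<le> (b (n + 2))\<^sup>2 * real (card S)"
    by (simp add: \<Omega>)
  also have "\<dots> = real (card ?\<Omega>) * b (n + 2) * real (card S)"
    by (simp add: \<Omega> power2_eq_square)
  also have "\<dots> \<le> real (card ?\<Omega>) * ((2 * real q) ^ k * b (n + 1)) * real (card S)"
    unfolding b_def using qbinomial_Suc_le[OF two_le_q kn]
    by (rule mult_right_mono[OF mult_left_mono[OF _ of_nat_0_le_iff] of_nat_0_le_iff])
  finally have "(Z * real (card S)) * (b (n + 1) * real (card S))
      \<le> (real (card ?\<Omega>) * (2 * real q) ^ k) * (b (n + 1) * real (card S))"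
    by (simp add: power2_eq_square mult_ac)
  moreover have "0 < b (n + 1) * real (card S)" using bpos False by simp
  ultimately show ?thesis unfolding Z_def by (simp only: mult_le_cancel_right_pos)
qed simp

text \<open>
  The dual bound, with the hyperplanes containing a member of \<open>\<A>\<close> as test objects. The hypothesis on
  intersections says that any two distinct members span the whole space.
\<close>

lemma card_distinguishing_le_dual:
  assumes \<A>: "\<A> \<subseteq> subspaces_of_dim K V (dim - k)" and k: "1 \<le> k" "k < dim" "2 * k \<le> dim"
    and l: "\<And>A B. A \<in> \<A> \<Longrightarrow> B \<in> \<A> \<Longrightarrow> A \<noteq> B \<Longrightarrow> card (A \<inter> B) \<le> q ^ (dim - 2 * k)"
  shows "real (card (distinguishing_subspaces K V k \<A>)) * real (card \<A>)
    \<le> real (card (subspaces_of_dim K V k)) * (2 ^ k * real q)"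
proof -
  let ?\<Omega> = "subspaces_of_dim K V k"
  define S where "S = (\<Union>A\<in>\<A>. between A (carrier V) (dim - 1))"
  have fin\<A>: "finite \<A>" using finite_family[OF \<A>] .
  have S: "S \<subseteq> subspaces_of_dim K V (dim - 1)" by (auto simp: S_def between_def)
  have sub: "distinguishing_subspaces K V k \<A> \<subseteq> {W \<in> ?\<Omega>. \<forall>h\<in>S. \<not> W \<subseteq> h}"
  proof
    fix W assume W: "W \<in> distinguishing_subspaces K V k \<A>"
    then have W\<Omega>: "W \<in> ?\<Omega>" by (simp add: distinguishing_subspaces_def)
    have "\<not> W \<subseteq> h" if h: "h \<in> S" for h
    proof
      assume Wh: "W \<subseteq> h"
      obtain A where A: "A \<in> \<A>" "A \<subseteq> h" using h by (auto simp: S_def between_def)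
      have "W \<inter> A = {\<zero>\<^bsub>V\<^esub>}"
        using W A by (simp add: distinguishing_subspaces_def distinguishes_def)
      then have "k + (dim - k) \<le> dim - 1 + 0"
        using A h S \<A> by (intro dim_add_le[OF W\<Omega> _ _ Wh]) auto
      then show False using k by simp
    qed
    then show "W \<in> {W \<in> ?\<Omega>. \<forall>h\<in>S. \<not> W \<subseteq> h}" using W\<Omega> by simp
  qed
  have disj: "between A (carrier V) (dim - 1) \<inter> between B (carrier V) (dim - 1) = {}"
    if AB: "A \<in> \<A>" "B \<in> \<A>" "A \<noteq> B" for A B
  proof (rule ccontr)
    assume "between A (carrier V) (dim - 1) \<inter> between B (carrier V) (dim - 1) \<noteq> {}"
    then obtain h where h: "h \<in> subspaces_of_dim K V (dim - 1)" "A \<subseteq> h" "B \<subseteq> h"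
      by (auto simp: between_def)
    have "dim - k + (dim - k) \<le> dim - 1 + (dim - 2 * k)"
      using AB \<A> by (intro dim_add_le[OF _ _ h] l) auto
    then show False using k by simp
  qed
  \<comment> \<open>Each member of \<open>\<A>\<close> lies in at least \<open>q^(k-1)\<close> hyperplanes, and no hyperplane contains two.\<close>
  have "real (card \<A>) * real q ^ (k - 1) = (\<Sum>A\<in>\<A>. real q ^ (k - 1))" by simp
  also have "\<dots> \<le> (\<Sum>A\<in>\<A>. real (card (between A (carrier V) (dim - 1))))"
    using \<A> k by (intro sum_mono card_hyperplanes_above) auto
  also have "\<dots> = real (card S)"
    unfolding S_def using disj fin\<A> finite_between by (subst card_UN_disjoint) auto
  finally have cS: "real (card \<A>) * real q ^ (k - 1) \<le> real (card S)" .
  define Z where "Z = real (card (distinguishing_subspaces K V k \<A>))"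
  have ZZ: "Z \<le> real (card {W \<in> ?\<Omega>. \<forall>h\<in>S. \<not> W \<subseteq> h})"
    unfolding Z_def using sub finite_subspaces_of_dim by (auto intro!: card_mono)
  have "Z * (real (card \<A>) * real q ^ (k - 1)) \<le> Z * real (card S)"
    using cS by (intro mult_left_mono) (auto simp: Z_def)
  also have "\<dots> \<le> real (card {W \<in> ?\<Omega>. \<forall>h\<in>S. \<not> W \<subseteq> h}) * real (card S)"
    using ZZ by (intro mult_right_mono) auto
  also have "\<dots> \<le> real (card ?\<Omega>) * (2 * real q) ^ k"
    using S k(1,2) by (rule card_not_below_hyperplanes)
  also have "(2 * real q) ^ k = 2 ^ k * real q * real q ^ (k - 1)"
    using k by (cases k) (auto simp: power_mult_distrib)
  finally have "(Z * real (card \<A>)) * real q ^ (k - 1)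
      \<le> (real (card ?\<Omega>) * (2 ^ k * real q)) * real q ^ (k - 1)"
    by (simp add: mult_ac)
  moreover have "0 < real q ^ (k - 1)" using two_le_q by simp
  ultimately show ?thesis unfolding Z_def by (simp only: mult_le_cancel_right_pos)
qed

end

section \<open>Asymptotics\<close>

lemma tendsto_0_bigo:
  fixes f g :: "nat \<Rightarrow> real"
  assumes "f \<in> O[F](g)" "(g \<longlongrightarrow> 0) F"
  shows "(f \<longlongrightarrow> 0) F"
proof -
  have "g \<in> o[F](\<lambda>_. 1)" using assms(2) by (intro smalloI_tendsto) auto
  with assms(1) have "f \<in> o[F](\<lambda>_. 1)" by (rule landau_o.big_small_trans)
  then show ?thesis using smalloD_tendsto by fastforce
qed

lemma filterlim_prime_powers: "filterlim real at_top prime_powers_at_top"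
  using filterlim_real_sequentially
  by (rule filterlim_mono) (auto simp: prime_powers_at_top_def)

lemma two_le_prime_power: "q \<in> prime_powers \<Longrightarrow> 2 \<le> q"
  using primepow_gt_Suc_0[of q] by (simp add: prime_powers_def)

lemma eventually_prime_powersI:
  "(\<And>q. q \<in> prime_powers \<Longrightarrow> P q) \<Longrightarrow> eventually P prime_powers_at_top"
  by (auto simp: eventually_prime_powers_at_top)

text \<open>
  The setting of the theorem. Everything is indexed by all natural numbers, but constrained only at
  prime powers.
\<close>

locale family_sequence =
  fixes K :: "nat \<Rightarrow> 'a ring" and X :: "nat \<Rightarrow> ('a, 'b) module"
    and \<A> :: "nat \<Rightarrow> 'b set set" and N k :: nat
  assumes field: "\<And>q. q \<in> prime_powers \<Longrightarrow> field (K q) \<and> card (carrier (K q)) = q"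
    and space: "\<And>q. q \<in> prime_powers \<Longrightarrow>
        vectorspace (K q) (X q) \<and> vectorspace.fin_dim (K q) (X q) \<and>
        vectorspace.dim (K q) (X q) = N"
    and k: "1 \<le> k" "k < N"
    and nonempty: "\<And>q. q \<in> prime_powers \<Longrightarrow> \<A> q \<noteq> {}"
    and codim: "\<And>q. q \<in> prime_powers \<Longrightarrow> \<A> q \<subseteq> subspaces_of_dim (K q) (X q) (N - k)"
begin

text \<open>The size of the collections, and the proportions of intersecting and of distinguishing subspaces.\<close>

definition a :: "nat \<Rightarrow> real" where
  "a q = real (card (\<A> q))"

definition F :: "nat \<Rightarrow> real" where
  "F q = real (card (intersecting_subspaces (K q) (X q) k (\<A> q))) / qbinomial q N k"

definition G :: "nat \<Rightarrow> real" where
  "G q = real (card (distinguishing_subspaces (K q) (X q) k (\<A> q))) / qbinomial q N k"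

lemma finite_vectorspace_q: "q \<in> prime_powers \<Longrightarrow> finite_vectorspace (K q) (X q)"
  using field[of q] space[of q] two_le_prime_power[of q]
  by (intro finite_vectorspaceI) (auto intro: card_ge_0_finite)

lemma card_scalars: "q \<in> prime_powers \<Longrightarrow> card (carrier (K q)) = q"
  and dim_eq: "q \<in> prime_powers \<Longrightarrow> vectorspace.dim (K q) (X q) = N"
  using field space by blast+

lemma card_subspaces_eq:
  assumes "q \<in> prime_powers"
  shows "real (card (subspaces_of_dim (K q) (X q) k)) = qbinomial q N k"
  using finite_vectorspace.card_subspaces_of_dim_qbinomial[OF finite_vectorspace_q[OF assms], of k]
    card_scalars[OF assms] dim_eq[OF assms] k by simp

lemma qbinomial_N_pos: "q \<in> prime_powers \<Longrightarrow> 0 < qbinomial q N k"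
  using qbinomial_pos[of q k N] two_le_prime_power k by simp

lemma one_le_a: "q \<in> prime_powers \<Longrightarrow> 1 \<le> a q"
  using finite_vectorspace.finite_family[OF finite_vectorspace_q codim] nonempty[of q]
  by (simp add: a_def card_gt_0_iff Suc_leI)

lemma a_nonneg: "0 \<le> a q"
  by (simp add: a_def)

lemma q_div_a_nonneg: "0 \<le> real q / a q"
  by (rule divide_nonneg_nonneg) (simp_all add: a_nonneg)

lemma F_nonneg: "q \<in> prime_powers \<Longrightarrow> 0 \<le> F q"
  and G_nonneg: "q \<in> prime_powers \<Longrightarrow> 0 \<le> G q"
  using qbinomial_N_pos[of q] by (simp_all add: F_def G_def)

lemma F_bigo: "F \<in> O[prime_powers_at_top](\<lambda>q. a q / real q)"
proof (rule bigoI[of _ 2], rule eventually_prime_powersI)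
  fix q assume q: "q \<in> prime_powers"
  have "real (card (intersecting_subspaces (K q) (X q) k (\<A> q)))
      \<le> qbinomial q N k * (2 * (real (card (\<A> q)) / real q))"
    using finite_vectorspace.card_intersecting_subspaces_le[OF finite_vectorspace_q[OF q], of "\<A> q" k]
      codim[OF q] card_scalars[OF q] dim_eq[OF q] k card_subspaces_eq[OF q] by simp
  then have "F q \<le> 2 * (a q / real q)"
    using qbinomial_N_pos[OF q] by (simp add: F_def a_def pos_divide_le_eq mult_ac)
  then show "norm (F q) \<le> 2 * norm (a q / real q)"
    using F_nonneg[OF q] one_le_a[OF q] by simp
qed

lemma G_bigoI:
  assumes "\<And>q. q \<in> prime_powers \<Longrightarrow> Q \<le> q \<Longrightarrow> G q \<le> c * g q" "\<And>q. q \<in> prime_powers \<Longrightarrow> 0 \<le> g q"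
  shows "G \<in> O[prime_powers_at_top](g)"
proof (rule bigoI[of _ c])
  have "norm (G q) \<le> c * norm (g q)" if "q \<in> prime_powers" "Q \<le> q" for q
    using assms(1)[OF that] assms(2)[OF that(1)] G_nonneg[OF that(1)] by simp
  then show "eventually (\<lambda>q. norm (G q) \<le> c * norm (g q)) prime_powers_at_top"
    unfolding eventually_prime_powers_at_top by blast
qed

lemma spread_bound:
  assumes "asymptotic_partial_spread K X (N - k) \<A>"
  obtains c Q where "\<And>q. q \<in> prime_powers \<Longrightarrow> Q \<le> q \<Longrightarrow> G q \<le> c * (real q / a q)"
proof -
  define U where "U q = real (card (\<Union>(\<A> q)))" for q
  have "U \<sim>[prime_powers_at_top] (\<lambda>q. a q * real q ^ (N - k))"
    using assms unfolding asymptotic_partial_spread_def U_def a_def by blast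
  then have "(\<lambda>q. a q * real q ^ (N - k)) \<in> O[prime_powers_at_top](U)"
    using asymp_equiv_imp_bigtheta bigthetaD2 asymp_equiv_sym by blast
  then obtain c where c: "c > 0"
    "eventually (\<lambda>q. norm (a q * real q ^ (N - k)) \<le> c * norm (U q)) prime_powers_at_top"
    by (elim landau_o.bigE)
  from c(2) obtain Q where Q:
    "\<forall>q\<in>prime_powers. Q \<le> q \<longrightarrow> norm (a q * real q ^ (N - k)) \<le> c * norm (U q)"
    unfolding eventually_prime_powers_at_top by blast
  have "G q \<le> (4 * c) * (real q / a q)" if q: "q \<in> prime_powers" and "Q \<le> q" for q
  proof -
    have elim: "norm (a q * real q ^ (N - k)) \<le> c * norm (U q)"
      using Q that by blast
    note V = finite_vectorspace_q[OF q]
    define T where "T = real q ^ (N - k)"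
    have T: "T > 0" using two_le_prime_power[OF q] by (simp add: T_def)
    have sub: "subspace (K q) A (X q) \<and> card A = q ^ (N - k)" if "A \<in> \<A> q" for A
      using that codim[OF q] finite_vectorspace.subspaces_of_dim_iff_card[OF V] card_scalars[OF q] by auto
    obtain A where A: "A \<in> \<A> q" using nonempty[OF q] by auto
    have fin: "finite (\<Union>(\<A> q))"
      using sub finite_vectorspace.subspace_finite[OF V] finite_vectorspace.finite_family[OF V, OF codim[OF q]] by auto
    define m where "m = real (card (\<Union>(\<A> q) - {\<zero>\<^bsub>X q\<^esub>}))"
    have "q ^ 1 \<le> q ^ (N - k)" using two_le_prime_power[OF q] k by (intro power_increasing) auto
    then have "2 \<le> card A" using sub[OF A] two_le_prime_power[OF q] by simp
    also have "card A \<le> card (\<Union>(\<A> q))" using fin A by (intro card_mono) auto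
    \<comment> \<open>Dropping the zero vector at most halves a union with two or more elements.\<close>
    finally have "U q \<le> 2 * m"
      using fin finite_vectorspace.subspace_zero[OF V, of A] sub[OF A] A by (auto simp: U_def m_def card_Diff_singleton_if)
    then have "c * U q \<le> c * (2 * m)" using c(1) by (intro mult_left_mono) auto
    moreover have "a q * T \<le> c * U q"
    proof -
      have "0 \<le> a q * T" "0 \<le> U q" using one_le_a[OF q] T by (auto simp: U_def)
      then show ?thesis using elim unfolding T_def[symmetric] real_norm_def by linarith
    qed
    ultimately have 1: "a q * T \<le> 2 * c * m" by linarith
    have 2: "G q * m \<le> 2 * real q * T"
      using finite_vectorspace.card_distinguishing_le_Union[OF V, of "\<A> q" k] sub card_scalars[OF q] dim_eq[OF q] k card_subspaces_eq[OF q] qbinomial_N_pos[OF q]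
      by (simp add: G_def m_def T_def pos_divide_le_eq mult_ac)
    have "G q * (a q * T) \<le> G q * (2 * c * m)" using 1 G_nonneg[OF q] by (rule mult_left_mono)
    also have "\<dots> = 2 * c * (G q * m)" by simp
    also have "\<dots> \<le> 2 * c * (2 * real q * T)" using 2 c(1) by (intro mult_left_mono) auto
    finally have "(G q * a q) * T \<le> (4 * c * real q) * T" by (simp add: mult_ac)
    then have "G q * a q \<le> 4 * c * real q" using T by simp
    then show "G q \<le> 4 * c * (real q / a q)"
      using one_le_a[OF q] by (simp add: pos_le_divide_eq)
  qed
  then show ?thesis using that by blast
qed

lemma card_Int_le:
  assumes q: "q \<in> prime_powers" and A: "A \<in> \<A> q" "A' \<in> \<A> q"
    and l: "int (subspace_dim (K q) (X q) (A \<inter> A')) \<le> int n"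
  shows "card (A \<inter> A') \<le> q ^ n"
proof -
  note V = finite_vectorspace_q[OF q]
  have "subspace (K q) (A \<inter> A') (X q)"
    using codim[OF q] A by (intro finite_vectorspace.subspace_Int[OF V]) (auto simp: subspaces_of_dim_def)
  then have "card (A \<inter> A') = q ^ subspace_dim (K q) (X q) (A \<inter> A')"
    using finite_vectorspace.card_subspace[OF V] card_scalars[OF q] by simp
  then show ?thesis using l two_le_prime_power[OF q] by (simp add: power_increasing)
qed

lemma G_le_Int:
  assumes q: "q \<in> prime_powers"
    and n: "\<And>A A'. A \<in> \<A> q \<Longrightarrow> A' \<in> \<A> q \<Longrightarrow> A \<noteq> A' \<Longrightarrow> card (A \<inter> A') \<le> q ^ n"
  shows "G q \<le> 8 * (real q / a q + real q / real q ^ (N - k) * (real q ^ n - 1))"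
proof -
  have "real (card (distinguishing_subspaces (K q) (X q) k (\<A> q)))
      \<le> qbinomial q N k * (8 * (real q / a q + real q / real q ^ (N - k) * (real q ^ n - 1)))"
    using finite_vectorspace.card_distinguishing_le_Int[OF finite_vectorspace_q[OF q], of "\<A> q" k n]
      codim[OF q] nonempty[OF q] n card_scalars[OF q] dim_eq[OF q] k card_subspaces_eq[OF q]
    by (simp add: a_def)
  then show ?thesis using qbinomial_N_pos[OF q] by (simp add: G_def pos_divide_le_eq mult_ac)
qed

lemma G_le_dual:
  assumes q: "q \<in> prime_powers" and kN: "2 * k \<le> N"
    and n: "\<And>A A'. A \<in> \<A> q \<Longrightarrow> A' \<in> \<A> q \<Longrightarrow> A \<noteq> A' \<Longrightarrow> card (A \<inter> A') \<le> q ^ (N - 2 * k)"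
  shows "G q \<le> 2 ^ k * (real q / a q)"
proof -
  have "real (card (distinguishing_subspaces (K q) (X q) k (\<A> q))) * a q
      \<le> qbinomial q N k * (2 ^ k * real q)"
    using finite_vectorspace.card_distinguishing_le_dual[OF finite_vectorspace_q[OF q], of "\<A> q" k]
      codim[OF q] n kN card_scalars[OF q] dim_eq[OF q] k card_subspaces_eq[OF q]
    by (simp add: a_def)
  then show ?thesis
    using qbinomial_N_pos[OF q] one_le_a[OF q]
    by (simp add: G_def divide_simps mult_ac)
qed

text \<open>
  When \<open>l\<close> is as small as the dimension formula allows, no error term occurs. For \<open>l = 0\<close> it
  vanishes in the bound by nonzero vectors; otherwise \<open>l = N - 2 k\<close>, and the dual bound applies.
\<close>

lemma minimal_Int_bound:
  assumes l: "l = max 0 (int N - 2 * int k)"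
    and Int: "\<And>q A A'. q \<in> prime_powers \<Longrightarrow> Q \<le> q \<Longrightarrow> A \<in> \<A> q \<Longrightarrow> A' \<in> \<A> q \<Longrightarrow> A \<noteq> A' \<Longrightarrow>
        int (subspace_dim (K q) (X q) (A \<inter> A')) \<le> l"
  obtains c where "\<And>q. q \<in> prime_powers \<Longrightarrow> Q \<le> q \<Longrightarrow> G q \<le> c * (real q / a q)"
proof (cases "2 * k < N")
  case True
  then have l': "l = int (N - 2 * k)" using l by simp
  have "G q \<le> 2 ^ k * (real q / a q)" if "q \<in> prime_powers" "Q \<le> q" for q
    using that(1) True by (intro G_le_dual card_Int_le) (use Int[OF that] l' in auto)
  then show ?thesis using that by blast
next
  case False
  then have l': "l = int 0" using l by simp
  have "G q \<le> 8 * (real q / a q + real q / real q ^ (N - k) * (real q ^ 0 - 1))"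
    if "q \<in> prime_powers" "Q \<le> q" for q
    using that(1) by (intro G_le_Int card_Int_le) (use Int[OF that] l' in auto)
  then show ?thesis using that[of 8] by simp
qed

lemma Int_bound:
  assumes l: "0 \<le> l"
    and Int: "\<And>q A A'. q \<in> prime_powers \<Longrightarrow> Q \<le> q \<Longrightarrow> A \<in> \<A> q \<Longrightarrow> A' \<in> \<A> q \<Longrightarrow> A \<noteq> A' \<Longrightarrow>
        int (subspace_dim (K q) (X q) (A \<inter> A')) \<le> l"
  obtains c where "\<And>q. q \<in> prime_powers \<Longrightarrow> Q \<le> q \<Longrightarrow>
    G q \<le> c * (real q / a q + real q powi (- int N + int k + l + 1))"
proof -
  let ?e = "- int N + int k + l + 1"
  define n where "n = nat l"
  have ln: "l = int n" using l by (simp add: n_def)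
  have "G q \<le> 8 * (real q / a q + real q powi ?e)"
    if q: "q \<in> prime_powers" "Q \<le> q" for q
  proof -
    have q0: "real q \<noteq> 0" using two_le_prime_power[OF q(1)] by simp
    have "real q powi ?e = real q powi ((1 + int n) - int (N - k))"
      using k ln by (simp add: of_nat_diff algebra_simps)
    also have "\<dots> = real q * real q ^ n / real q ^ (N - k)"
      using q0 by (simp add: power_int_diff power_int_add)
    finally have "real q / real q ^ (N - k) * (real q ^ n - 1) \<le> real q powi ?e"
      by (simp add: right_diff_distrib)
    moreover have "G q \<le> 8 * (real q / a q + real q / real q ^ (N - k) * (real q ^ n - 1))"
      using q(1) by (intro G_le_Int card_Int_le) (use Int[OF q] ln in auto)
    ultimately show ?thesis by simp
  qed
  then show ?thesis using that by blast
qed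

lemma tendsto_q_div_a:
  assumes "(\<lambda>q. real q) \<in> o[prime_powers_at_top](a)"
  shows "((\<lambda>q. real q / a q) \<longlongrightarrow> 0) prime_powers_at_top"
  using smalloD_tendsto[OF assms] .

lemma partial_spread:
  assumes "asymptotic_partial_spread K X (N - k) \<A>"
  shows "G \<in> O[prime_powers_at_top](\<lambda>q. real q / a q)"
proof -
  obtain c Q where c: "\<And>q. q \<in> prime_powers \<Longrightarrow> Q \<le> q \<Longrightarrow> G q \<le> c * (real q / a q)"
    using spread_bound[OF assms] by blast
  show ?thesis by (rule G_bigoI[OF c]) (simp_all add: q_div_a_nonneg)
qed

lemma small_intersections:
  assumes small: "(\<lambda>q. real q) \<in> o[prime_powers_at_top](a)"
    and l: "(max 0 (int N - 2 * int k) \<le> l \<and> l < int N - int k - 1) \<or>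
       (l = max 0 (int N - 2 * int k) \<and> l = int N - int k - 1)"
    and Int: "\<And>q A A'. q \<in> prime_powers \<Longrightarrow> Q \<le> q \<Longrightarrow> A \<in> \<A> q \<Longrightarrow> A' \<in> \<A> q \<Longrightarrow> A \<noteq> A' \<Longrightarrow>
        int (subspace_dim (K q) (X q) (A \<inter> A')) \<le> l"
  shows "(l = max 0 (int N - 2 * int k) \<longrightarrow> G \<in> O[prime_powers_at_top](\<lambda>q. real q / a q)) \<and>
     (l > max 0 (int N - 2 * int k) \<longrightarrow>
        G \<in> O[prime_powers_at_top](\<lambda>q. real q / a q + real q powi (- int N + int k + l + 1))) \<and>
     (G \<longlongrightarrow> 0) prime_powers_at_top"
proof -
  let ?e = "- int N + int k + l + 1"
  have A: "G \<in> O[prime_powers_at_top](\<lambda>q. real q / a q)" if leq: "l = max 0 (int N - 2 * int k)"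
  proof -
    obtain c where c: "\<And>q. q \<in> prime_powers \<Longrightarrow> Q \<le> q \<Longrightarrow> G q \<le> c * (real q / a q)"
      using minimal_Int_bound[OF leq Int] by blast
    show ?thesis by (rule G_bigoI[OF c]) (simp_all add: q_div_a_nonneg)
  qed
  have B: "G \<in> O[prime_powers_at_top](\<lambda>q. real q / a q + real q powi ?e)"
  proof -
    have "0 \<le> l" using l by auto
    then obtain c where c: "\<And>q. q \<in> prime_powers \<Longrightarrow> Q \<le> q \<Longrightarrow> G q \<le> c * (real q / a q + real q powi ?e)"
      using Int_bound[OF _ Int] by blast
    show ?thesis by (rule G_bigoI[OF c]) (simp_all add: q_div_a_nonneg)
  qed
  have "(G \<longlongrightarrow> 0) prime_powers_at_top"
  proof (cases "l = max 0 (int N - 2 * int k)")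
    case True
    then show ?thesis using tendsto_0_bigo[OF A tendsto_q_div_a[OF small]] by simp
  next
    case False
    then have e: "?e \<le> -1" using l by auto
    have inv0: "((\<lambda>q. inverse (real q)) \<longlongrightarrow> 0) prime_powers_at_top"
      using tendsto_inverse_0_at_top[OF filterlim_prime_powers] .
    have "((\<lambda>q. real q powi ?e) \<longlongrightarrow> 0) prime_powers_at_top"
    proof (rule tendsto_sandwich[OF _ _ tendsto_const inv0])
      show "\<forall>\<^sub>F q in prime_powers_at_top. 0 \<le> real q powi ?e" by simp
      show "\<forall>\<^sub>F q in prime_powers_at_top. real q powi ?e \<le> inverse (real q)"
      proof (rule eventually_prime_powersI)
        fix q assume "q \<in> prime_powers"
        then have "1 \<le> real q" using two_le_prime_power[of q] by simp
        then have "real q powi ?e \<le> real q powi (-1)" using e by (intro power_int_increasing) auto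
        then show "real q powi ?e \<le> inverse (real q)" by (simp add: power_int_minus)
      qed
    qed
    then have "((\<lambda>q. real q / a q + real q powi ?e) \<longlongrightarrow> 0 + 0) prime_powers_at_top"
      by (intro tendsto_add tendsto_q_div_a small)
    then show ?thesis using tendsto_0_bigo[OF B] by simp
  qed
  then show ?thesis using A B by blast
qed

end

theorem theorem4p7:
  fixes K :: "nat \<Rightarrow> 'a ring"
    and X :: "nat \<Rightarrow> ('a, 'b) module"
    and \<A> :: "nat \<Rightarrow> 'b set set"
    and N k :: nat
  assumes field: "\<And>q. q \<in> prime_powers \<Longrightarrow> field (K q) \<and> card (carrier (K q)) = q"
    and space: "\<And>q. q \<in> prime_powers \<Longrightarrow>
        vectorspace (K q) (X q) \<and> vectorspace.fin_dim (K q) (X q) \<and>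
        vectorspace.dim (K q) (X q) = N"
    and N: "3 \<le> N"
    and k: "1 \<le> k" "k \<le> N - 1"
    and nonempty: "\<And>q. q \<in> prime_powers \<Longrightarrow> \<A> q \<noteq> {}"
    and codim: "\<And>q. q \<in> prime_powers \<Longrightarrow> \<A> q \<subseteq> subspaces_of_dim (K q) (X q) (N - k)"
  shows
    "((\<lambda>q. real (card (intersecting_subspaces (K q) (X q) k (\<A> q))) / qbinomial q N k)
       \<in> O[prime_powers_at_top](\<lambda>q. real (card (\<A> q)) / real q)
     \<and> ((\<lambda>q. real (card (\<A> q))) \<in> o[prime_powers_at_top](\<lambda>q. real q) \<longrightarrow>
        ((\<lambda>q. real (card (intersecting_subspaces (K q) (X q) k (\<A> q))) / qbinomial q N k)
           \<longlongrightarrow> 0) prime_powers_at_top)) \<and>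
    (asymptotic_partial_spread K X (N - k) \<A> \<longrightarrow>
       (\<lambda>q. real (card (distinguishing_subspaces (K q) (X q) k (\<A> q))) / qbinomial q N k)
         \<in> O[prime_powers_at_top](\<lambda>q. real q / real (card (\<A> q)))
       \<and> ((\<lambda>q. real q) \<in> o[prime_powers_at_top](\<lambda>q. real (card (\<A> q))) \<longrightarrow>
          ((\<lambda>q. real (card (distinguishing_subspaces (K q) (X q) k (\<A> q))) / qbinomial q N k)
             \<longlongrightarrow> 0) prime_powers_at_top)) \<and>
    ((\<lambda>q. real q) \<in> o[prime_powers_at_top](\<lambda>q. real (card (\<A> q))) \<longrightarrow>
     (\<forall>q0\<in>prime_powers. \<forall>l::int.
        ((max 0 (int N - 2 * int k) \<le> l \<and> l < int N - int k - 1) \<or>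
         (l = max 0 (int N - 2 * int k) \<and> l = int N - int k - 1)) \<and>
        (\<forall>q\<in>prime_powers. q0 \<le> q \<longrightarrow>
           (\<forall>A\<in>\<A> q. \<forall>A'\<in>\<A> q. A \<noteq> A' \<longrightarrow>
              int (subspace_dim (K q) (X q) (A \<inter> A')) \<le> l)) \<longrightarrow>
        (l = max 0 (int N - 2 * int k) \<longrightarrow>
           (\<lambda>q. real (card (distinguishing_subspaces (K q) (X q) k (\<A> q))) / qbinomial q N k)
             \<in> O[prime_powers_at_top](\<lambda>q. real q / real (card (\<A> q)))) \<and>
        (l > max 0 (int N - 2 * int k) \<longrightarrow>
           (\<lambda>q. real (card (distinguishing_subspaces (K q) (X q) k (\<A> q))) / qbinomial q N k)
             \<in> O[prime_powers_at_top](\<lambda>q. real q / real (card (\<A> q)) +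
                    real q powi (- int N + int k + l + 1))) \<and>
        ((\<lambda>q. real (card (distinguishing_subspaces (K q) (X q) k (\<A> q))) / qbinomial q N k)
           \<longlongrightarrow> 0) prime_powers_at_top))"
proof -
  interpret S: family_sequence K X \<A> N k
    by (rule family_sequence.intro) (use field space nonempty codim k N in auto)
  show ?thesis
    unfolding S.F_def[symmetric] S.G_def[symmetric] S.a_def[symmetric]
    apply (intro conjI)
    subgoal by (rule S.F_bigo)
    subgoal using tendsto_0_bigo[OF S.F_bigo smalloD_tendsto] by (rule impI)
    subgoal using S.partial_spread tendsto_0_bigo[OF S.partial_spread S.tendsto_q_div_a] by (intro impI conjI)
    subgoal
    proof (intro impI ballI allI, elim conjE)
      fix q0 l
      assume small: "(\<lambda>q. real q) \<in> o[prime_powers_at_top](S.a)"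
        and l: "(max 0 (int N - 2 * int k) \<le> l \<and> l < int N - int k - 1) \<or>
          (l = max 0 (int N - 2 * int k) \<and> l = int N - int k - 1)"
        and Int: "\<forall>q\<in>prime_powers. q0 \<le> q \<longrightarrow>
          (\<forall>A\<in>\<A> q. \<forall>A'\<in>\<A> q. A \<noteq> A' \<longrightarrow> int (subspace_dim (K q) (X q) (A \<inter> A')) \<le> l)"
      show "(l = max 0 (int N - 2 * int k) \<longrightarrow> S.G \<in> O[prime_powers_at_top](\<lambda>q. real q / S.a q)) \<and>
        (l > max 0 (int N - 2 * int k) \<longrightarrow>
          S.G \<in> O[prime_powers_at_top](\<lambda>q. real q / S.a q + real q powi (- int N + int k + l + 1))) \<and>
        (S.G \<longlongrightarrow> 0) prime_powers_at_top"
        using Int by (intro S.small_intersections[OF small l, where Q = q0]) simp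
    qed
    done
qed

end
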